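(* Let $\varepsilon>0$, assume that $\lambda>\lambda_0=3/2^{2/3}$, and assume that there is an $\bar\alpha\in(\alpha_0,-\sqrt{\lambda/3})$ such that $u_{\bar\alpha}(t)$ increases monotonically as $t$ increases from $0$ and crosses $u=b$ before $t=\pi/2$. Let $\{w_k\}$ be the associated family of spike solutions. Let $\Sigma=\{\sigma_k\}$ be any sequence of positive integers such that $\sigma_{k+1}-\sigma_k\ge 2$ for all $k$ ($\Sigma$ may be infinite, finite, or empty). Then there is an $\alpha_\Sigma\in(\alpha_0,\bar\alpha)$ such that $u_{\alpha_\Sigma}$ exists on $(-\infty,\infty)$, and on $(0,\infty)$ the graph of $u_{\alpha_\Sigma}$ intersects the graph of each $w_{\sigma_k}$, but does not intersect the graph of any $w_j$ with $j\notin\Sigma$.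
   Context: For $\alpha\in\mathbb{R}$, $u_\alpha$ denotes the solution of $\varepsilon^2u''=u^3-\lambda u+\cos t$ with $u(0)=\alpha$, $u'(0)=0$ (on its maximal interval of existence). The number $b>0$ is fixed with $b^3-\lambda b-1>0$ (so $u''>0$ when $u\ge b$ and $u''<0$ when $u\le -b$). $\alpha_0$ is the smallest real root of $u^3-\lambda u+1=0$. Given $\bar\alpha$ as in the hypothesis, define $\hat w_k(t)=(-1)^k u_{\bar\alpha}(t-k\pi)$, and let $w_k$ be the restriction of $\hat w_k$ to the interval $[s_k,S_k]$ (containing $k\pi$, of half-length less than $\pi/2$) in which $|\hat w_k|\le b$. *)

theory Defs
  imports "HOL-Analysis.Analysis" "HOL-Library.Extended_Nat"
begin

definition ivp_solution :: "real \<Rightarrow> real \<Rightarrow> real \<Rightarrow> real set \<Rightarrow> (real \<Rightarrow> real) \<Rightarrow> bool" where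
  "ivp_solution \<epsilon> lam \<alpha> I u \<longleftrightarrow>
     open I \<and> is_interval I \<and> 0 \<in> I \<and> u 0 = \<alpha> \<and> deriv u 0 = 0 \<and>
     (\<forall>t\<in>I. u differentiable (at t) \<and> deriv u differentiable (at t) \<and>
        \<epsilon>^2 * deriv (deriv u) t = (u t)^3 - lam * u t + cos t)"

definition max_interval :: "real \<Rightarrow> real \<Rightarrow> real \<Rightarrow> real set" where
  "max_interval \<epsilon> lam \<alpha> = \<Union>{I. \<exists>u. ivp_solution \<epsilon> lam \<alpha> I u}"

(* All local solutions agree where they are both defined, as the right-hand side is smooth
   (for \<epsilon> \<noteq> 0).  Their common value is u_\<alpha>(t); it carries no information for t outside
   max_interval. *)
definition sol :: "real \<Rightarrow> real \<Rightarrow> real \<Rightarrow> real \<Rightarrow> real" where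
  "sol \<epsilon> lam \<alpha> t = (THE y. \<exists>I u. ivp_solution \<epsilon> lam \<alpha> I u \<and> t \<in> I \<and> y = u t)"

definition alpha0 :: "real \<Rightarrow> real" where
  "alpha0 lam = (LEAST x. x^3 - lam * x + 1 = 0)"

definition lambda0 :: real where
  "lambda0 = 3 / 2 powr (2/3)"

definition spike_ext :: "real \<Rightarrow> real \<Rightarrow> real \<Rightarrow> int \<Rightarrow> real \<Rightarrow> real" where
  "spike_ext \<epsilon> lam \<alpha> k t = (-1) powi k * sol \<epsilon> lam \<alpha> (t - of_int k * pi)"

(* The interval [s_k, S_k]: the component around k * pi of the set of times at which the shifted
   solution exists and lies in [-b, b]. *)
definition spike_interval :: "real \<Rightarrow> real \<Rightarrow> real \<Rightarrow> real \<Rightarrow> int \<Rightarrow> real set" where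
  "spike_interval \<epsilon> lam b \<alpha> k =
     connected_component_set
       {t. t - of_int k * pi \<in> max_interval \<epsilon> lam \<alpha> \<and> \<bar>spike_ext \<epsilon> lam \<alpha> k t\<bar> \<le> b}
       (of_int k * pi)"

definition graph_on :: "(real \<Rightarrow> real) \<Rightarrow> real set \<Rightarrow> (real \<times> real) set" where
  "graph_on f A = (\<lambda>t. (t, f t)) ` A"

definition spike_graph :: "real \<Rightarrow> real \<Rightarrow> real \<Rightarrow> real \<Rightarrow> int \<Rightarrow> (real \<times> real) set" where
  "spike_graph \<epsilon> lam b \<alpha> k = graph_on (spike_ext \<epsilon> lam \<alpha> k) (spike_interval \<epsilon> lam b \<alpha> k)"

end

theory Submission
  imports Defs
begin

text \<open>
  Truncating the cubic outside \<open>[-b-1, b+1]\<close> makes all solutions global and continuous in \<open>\<alpha>\<close>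
  without changing those that stay in the strip \<open>[-b, b]\<close>; a trajectory that leaves the strip never
  returns.  The symmetry \<open>(t, u) \<mapsto> (t + pi, -u)\<close> maps each spike to the next one, so that all spikes
  look like \<open>w\<^sub>0\<close>.

  One shoots with nested parameter intervals, whose ends leave the strip on opposite sides.  A
  trajectory cannot touch a spike from one side, by uniqueness, and cannot touch \<open>u = -r\<close>,
  \<open>r = sqrt (lam / 3)\<close>, from below, since \<open>u'' > 0\<close> there.  Hence, when the interval is shrunk to the
  first parameter whose trajectory violates the wanted behaviour, that trajectory leaves the strip
  exactly at the far corner of the current spike.  To avoid the next spike one keeps the parameters
  that pass over it; to meet it one keeps those staying in \<open>u < -r\<close> up to the spike after it.
  The bounded trajectory with the prescribed pattern is a common point of all the intervals.
\<close>

section \<open>Second-order equations\<close>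

text \<open>The constants come from balancing the cubic against the extreme values of the forcing.
  The cubic u^3 - lam u has its local maximum 2 r^3 at -r, and lam > lambda0 says exactly that 2 r^3
  > 1, so there it dominates cos t; left of -r it increases, which yields a maximum principle. At
  \<open>alpha0 lam\<close> it equals -1, so the acceleration is nonpositive at and below that
  level: the trajectory from there sinks out of the strip and supplies the first lower end. The gap
  of two in the pattern comes from the crossing step: a trajectory that stays in u < -r from spike m
  to spike m + 2 meets spike m + 1 and passes under spike m + 2, so one step consumes two spikes and
  the second of them has to be an avoided one.\<close>

lemma second_order_gronwall:
  fixes d d1 d2 :: "real \<Rightarrow> real"
  assumes "a \<le> c" "K \<ge> 0"
    and d: "\<And>t. a \<le> t \<Longrightarrow> t \<le> c \<Longrightarrow> (d has_real_derivative d1 t) (at t)"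
    and d1: "\<And>t. a \<le> t \<Longrightarrow> t \<le> c \<Longrightarrow> (d1 has_real_derivative d2 t) (at t)"
    and d2: "\<And>t. a \<le> t \<Longrightarrow> t \<le> c \<Longrightarrow> \<bar>d2 t\<bar> \<le> K * \<bar>d t\<bar>"
  shows "(d c)\<^sup>2 + (d1 c)\<^sup>2 \<le> ((d a)\<^sup>2 + (d1 a)\<^sup>2) * exp ((1 + K) * (c - a))"
proof -
  \<comment> \<open>The energy d^2 + d1^2 grows at most at rate 1 + K, because 2 |d| |d1| <= d^2 +
    d1^2 controls both 2 d d1 and 2 d1 d2; the exponential factor absorbs this growth.\<close>
  let ?g = "\<lambda>t. ((d t)\<^sup>2 + (d1 t)\<^sup>2) * exp (- ((1 + K) * t))"
  have "?g c \<le> ?g a"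
  proof (rule DERIV_nonpos_imp_nonincreasing[OF \<open>a \<le> c\<close>])
    fix t assume t: "a \<le> t" "t \<le> c"
    have D: "(?g has_real_derivative
        (2 * d t * d1 t + 2 * d1 t * d2 t - (1 + K) * ((d t)\<^sup>2 + (d1 t)\<^sup>2)) * exp (- ((1 + K) * t))) (at t)"
      by (auto intro!: derivative_eq_intros d[OF t] d1[OF t] simp: algebra_simps)
    have amgm: "2 * \<bar>d t\<bar> * \<bar>d1 t\<bar> \<le> (d t)\<^sup>2 + (d1 t)\<^sup>2"
      using sum_squares_bound[of "\<bar>d t\<bar>" "\<bar>d1 t\<bar>"] by simp
    have "2 * d t * d1 t \<le> 2 * \<bar>d t\<bar> * \<bar>d1 t\<bar>"
      using abs_ge_self[of "d t * d1 t"] by (simp add: abs_mult)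
    moreover have "2 * d1 t * d2 t \<le> 2 * \<bar>d1 t\<bar> * (K * \<bar>d t\<bar>)"
    proof -
      have "2 * d1 t * d2 t \<le> 2 * \<bar>d1 t\<bar> * \<bar>d2 t\<bar>"
        using abs_ge_self[of "d1 t * d2 t"] by (simp add: abs_mult)
      also have "\<dots> \<le> 2 * \<bar>d1 t\<bar> * (K * \<bar>d t\<bar>)"
        using d2[OF t] by (intro mult_left_mono) auto
      finally show ?thesis .
    qed
    moreover have "2 * \<bar>d1 t\<bar> * (K * \<bar>d t\<bar>) \<le> K * ((d t)\<^sup>2 + (d1 t)\<^sup>2)"
      using mult_left_mono[OF amgm \<open>K \<ge> 0\<close>] by (simp add: mult_ac)
    ultimately have "2 * d t * d1 t + 2 * d1 t * d2 t - (1 + K) * ((d t)\<^sup>2 + (d1 t)\<^sup>2) \<le> 0"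
      using amgm by (simp add: algebra_simps)
    then show "\<exists>y. (?g has_real_derivative y) (at t) \<and> y \<le> 0"
      using D mult_nonpos_nonneg[OF _ exp_ge_zero] by blast
  qed
  then have "?g c * exp ((1 + K) * c) \<le> ?g a * exp ((1 + K) * c)"
    by (rule mult_right_mono) simp
  moreover have "exp (- ((1 + K) * c)) * exp ((1 + K) * c) = 1"
    by (simp add: mult.assoc flip: exp_add)
  moreover have "exp (- ((1 + K) * a)) * exp ((1 + K) * c) = exp ((1 + K) * (c - a))"
    by (simp add: exp_add[symmetric] algebra_simps)
  ultimately show ?thesis by (simp add: mult.assoc)
qed

text \<open>Meant for the difference of two solutions. \<open>closed_segment\<close> serves both
  time directions; the backward one is the forward estimate for the reflected function.\<close>

lemma second_order_unique:
  fixes d d1 d2 :: "real \<Rightarrow> real"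
  assumes "K \<ge> 0"
    and d: "\<And>t. t \<in> closed_segment a c \<Longrightarrow> (d has_real_derivative d1 t) (at t)"
    and d1: "\<And>t. t \<in> closed_segment a c \<Longrightarrow> (d1 has_real_derivative d2 t) (at t)"
    and d2: "\<And>t. t \<in> closed_segment a c \<Longrightarrow> \<bar>d2 t\<bar> \<le> K * \<bar>d t\<bar>"
    and "d a = 0" "d1 a = 0"
  shows "d c = 0"
proof (cases "a \<le> c")
  case True
  then have "(d c)\<^sup>2 + (d1 c)\<^sup>2 \<le> ((d a)\<^sup>2 + (d1 a)\<^sup>2) * exp ((1 + K) * (c - a))"
    using assms by (intro second_order_gronwall[where ?d2.0 = d2]) (auto simp: closed_segment_eq_real_ivl)
  then show ?thesis using assms by (simp add: sum_power2_le_zero_iff)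
next
  case False
  then have seg: "closed_segment a c = {c..a}" by (simp add: closed_segment_eq_real_ivl)
  let ?d = "\<lambda>t. d (- t)" and ?d1 = "\<lambda>t. - d1 (- t)" and ?d2 = "\<lambda>t. d2 (- t)"
  have "(?d (- c))\<^sup>2 + (?d1 (- c))\<^sup>2 \<le> ((?d (- a))\<^sup>2 + (?d1 (- a))\<^sup>2) * exp ((1 + K) * (- c - (- a)))"
  proof (rule second_order_gronwall[where ?d2.0 = ?d2])
    fix t assume t: "- a \<le> t" "t \<le> - c"
    then have m: "- t \<in> closed_segment a c" by (auto simp: seg)
    show "(?d has_real_derivative ?d1 t) (at t)"
      using d[OF m] by (simp add: DERIV_mirror)
    have "((\<lambda>t. d1 (- t)) has_real_derivative - d2 (- t)) (at t)"
      using d1[OF m] by (simp add: DERIV_mirror)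
    from DERIV_minus[OF this] show "(?d1 has_real_derivative ?d2 t) (at t)" by simp
    show "\<bar>?d2 t\<bar> \<le> K * \<bar>?d t\<bar>" using d2[OF m] .
  qed (use False assms in auto)
  then show ?thesis using assms by (simp add: sum_power2_le_zero_iff)
qed

section \<open>Crossing times and extremal points of parameter segments\<close>

lemma first_hit:
  fixes y :: "real \<Rightarrow> real"
  assumes "continuous_on {a..c} y" "a \<le> c" "y a < k" "y c \<ge> k"
  obtains s where "a < s" "s \<le> c" "y s = k" "\<And>x. a \<le> x \<Longrightarrow> x < s \<Longrightarrow> y x < k"
proof -
  define S where "S = {a..c} \<inter> y -` {k..}"
  have "closed S"
    unfolding S_def using continuous_closed_preimage[OF assms(1)] by auto
  then have "compact S" by (auto simp: S_def compact_eq_bounded_closed)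
  moreover have "c \<in> S" using assms by (auto simp: S_def)
  ultimately obtain s where s: "s \<in> S" "\<And>x. x \<in> S \<Longrightarrow> s \<le> x"
    using compact_attains_inf[of S] by blast
  have st: "a \<le> s" "s \<le> c" "y s \<ge> k" using s by (auto simp: S_def)
  have below: "y x < k" if "a \<le> x" "x < s" for x
    using s(2)[of x] that st by (force simp: S_def)
  have "\<exists>x\<ge>a. x \<le> s \<and> y x = k"
    using assms st by (intro IVT') (auto intro: continuous_on_subset)
  then have "y s = k" using below by (metis order_le_less less_irrefl)
  moreover from this have "a < s" using st assms by (cases "a = s") auto
  ultimately show ?thesis using that st below by blast
qed

text \<open>The set is the projection of a compact subset of the product. With F the height of a
  trajectory above an obstacle, it collects the parameters that reach the obstacle within a compact
  time window.\<close>

lemma compact_exists_nonneg: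
  fixes F :: "'a::t2_space \<times> 'b::t2_space \<Rightarrow> real"
  assumes "continuous_on UNIV F" "compact K" "compact A"
  shows "compact {x \<in> K. \<exists>t\<in>A. 0 \<le> F (x, t)}"
proof -
  have "closed (F -` {0..})"
    using assms(1) by (intro closed_vimage) auto
  then have "compact ((K \<times> A) \<inter> F -` {0..})"
    using assms by (intro compact_Int_closed compact_Times)
  then have "compact (fst ` ((K \<times> A) \<inter> F -` {0..}))"
    by (intro compact_continuous_image continuous_intros)
  moreover have "fst ` ((K \<times> A) \<inter> F -` {0..}) = {x \<in> K. \<exists>t\<in>A. 0 \<le> F (x, t)}"
    by force
  ultimately show ?thesis by simp
qed

text \<open>Shrinking from a good end p to the first bad parameter. Distance replaces order, because
  the ends of a segment come in no fixed order.\<close>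

lemma closest_in_segment:
  fixes p q :: "'a::euclidean_space"
  assumes "compact Y" "Y \<subseteq> closed_segment p q" "Y \<noteq> {}" "p \<notin> Y"
  obtains y where "y \<in> Y" "y \<noteq> p" "\<And>x. x \<in> closed_segment p y \<Longrightarrow> x \<noteq> y \<Longrightarrow> x \<notin> Y"
proof -
  have "continuous_on Y (\<lambda>x. dist p x)" by (intro continuous_intros)
  then obtain y where y: "y \<in> Y" "\<And>x. x \<in> Y \<Longrightarrow> dist p y \<le> dist p x"
    using continuous_attains_inf[of Y "\<lambda>x. dist p x"] assms by blast
  have "x \<notin> Y" if x: "x \<in> closed_segment p y" "x \<noteq> y" for x
  proof
    assume "x \<in> Y"
    obtain u where u: "x = (1 - u) *\<^sub>R p + u *\<^sub>R y" "0 \<le> u" "u \<le> 1"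
      using x by (auto simp: closed_segment_def)
    have "u < 1" using u x by (cases "u = 1") auto
    have "p - x = u *\<^sub>R (p - y)" by (simp add: u algebra_simps)
    then have "dist p x = u * dist p y" using u by (simp add: dist_norm)
    moreover have "dist p y > 0" using y assms by auto
    ultimately have "dist p x < dist p y" using \<open>u < 1\<close> by simp
    then show False using y(2)[OF \<open>x \<in> Y\<close>] by simp
  qed
  moreover have "y \<noteq> p" using y assms by auto
  ultimately show ?thesis using that y by blast
qed

text \<open>Strict inequalities valid before the first bad parameter survive there as weak ones,
  which turns the contact at that parameter into a one-sided one.\<close>

lemma le_on_closed_segment:
  fixes g :: "'a::euclidean_space \<Rightarrow> real"
  assumes "continuous_on UNIV g" "p \<noteq> q" "\<And>x. x \<in> open_segment p q \<Longrightarrow> g x \<le> k"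
    and "x \<in> closed_segment p q"
  shows "g x \<le> k"
  using continuous_le_on_closure[of "open_segment p q" g x k] assms
  by (simp add: continuous_on_subset[OF assms(1)])

section \<open>Global existence for bounded Lipschitz right-hand sides\<close>

lemma antiderivative_exists:
  fixes f :: "real \<Rightarrow> real"
  assumes "continuous_on UNIV f"
  shows "\<exists>F. F 0 = 0 \<and> (\<forall>t. (F has_real_derivative f t) (at t))"
proof (intro exI conjI allI)
  show "(LBINT y=0..ereal 0. f y) = 0"
    by (simp add: zero_ereal_def[symmetric])
  fix t :: real
  let ?R = "\<bar>t\<bar> + 1"
  have "((\<lambda>u. LBINT y=ereal 0..ereal u. f y) has_vector_derivative f t) (at t within {-?R..?R})"
    by (rule interval_integral_FTC2) (auto intro: continuous_on_subset[OF assms])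
  moreover have "at t within {-?R..?R} = at t"
    by (rule at_within_interior) (auto simp: interior_atLeastAtMost_real)
  ultimately show "((\<lambda>u. LBINT y=0..ereal u. f y) has_real_derivative f t) (at t)"
    by (simp add: has_real_derivative_iff_has_vector_derivative zero_ereal_def)
qed

text \<open>Each integration reproduces the weight exp (c t) and gains a factor 1 / c; the two gains
  make the integral operator contract for large c.\<close>

lemma second_antiderivative_bound_right:
  fixes F F1 g :: "real \<Rightarrow> real"
  assumes F: "\<And>t. (F has_real_derivative F1 t) (at t)"
    and F1: "\<And>t. (F1 has_real_derivative g t) (at t)"
    and "F 0 = 0" "F1 0 = 0" "c > 0" "N \<ge> 0"
    and g: "\<And>t. t \<ge> 0 \<Longrightarrow> g t \<le> N * exp (c * t)"
    and "t \<ge> 0"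
  shows "F t \<le> N * exp (c * t) / c\<^sup>2"
proof -
  have 1: "F1 s \<le> N * exp (c * s) / c" if "s \<ge> 0" for s
  proof -
    have "F1 s - N * exp (c * s) / c \<le> F1 0 - N * exp (c * 0) / c"
    proof (rule DERIV_nonpos_imp_nonincreasing[OF that])
      fix x assume "0 \<le> x" "x \<le> s"
      have "((\<lambda>s. F1 s - N * exp (c * s) / c) has_real_derivative g x - N * exp (c * x)) (at x)"
        using \<open>c > 0\<close> by (auto intro!: derivative_eq_intros F1)
      then show "\<exists>y. ((\<lambda>s. F1 s - N * exp (c * s) / c) has_real_derivative y) (at x) \<and> y \<le> 0"
        using g[OF \<open>0 \<le> x\<close>] by force
    qed
    also have "\<dots> \<le> 0" using assms by simp
    finally show ?thesis by simp
  qed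
  have "F t - N * exp (c * t) / c\<^sup>2 \<le> F 0 - N * exp (c * 0) / c\<^sup>2"
  proof (rule DERIV_nonpos_imp_nonincreasing[OF \<open>t \<ge> 0\<close>])
    fix x assume "0 \<le> x" "x \<le> t"
    have "((\<lambda>s. F s - N * exp (c * s) / c\<^sup>2) has_real_derivative F1 x - N * exp (c * x) / c) (at x)"
      using \<open>c > 0\<close> by (auto intro!: derivative_eq_intros F simp: power2_eq_square)
    then show "\<exists>y. ((\<lambda>s. F s - N * exp (c * s) / c\<^sup>2) has_real_derivative y) (at x) \<and> y \<le> 0"
      using 1[OF \<open>0 \<le> x\<close>] by force
  qed
  also have "\<dots> \<le> 0" using assms by simp
  finally show ?thesis by simp
qed

lemma second_antiderivative_bound:
  fixes F F1 g :: "real \<Rightarrow> real"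
  assumes F: "\<And>t. (F has_real_derivative F1 t) (at t)"
    and F1: "\<And>t. (F1 has_real_derivative g t) (at t)"
    and "F 0 = 0" "F1 0 = 0" "c > 0" "N \<ge> 0"
    and g: "\<And>t. \<bar>g t\<bar> \<le> N * exp (c * \<bar>t\<bar>)"
  shows "\<bar>F t\<bar> \<le> N * exp (c * \<bar>t\<bar>) / c\<^sup>2"
proof -
  have F': "((\<lambda>t. F (- t)) has_real_derivative - F1 (- t)) (at t)" for t
    using F[of "- t"] by (simp add: DERIV_mirror)
  have "((\<lambda>t. F1 (- t)) has_real_derivative - g (- t)) (at t)" for t
    using F1[of "- t"] by (simp add: DERIV_mirror)
  from DERIV_minus[OF this]
  have F1': "((\<lambda>t. - F1 (- t)) has_real_derivative g (- t)) (at t)" for t by simp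
  note mF = DERIV_minus[OF F] DERIV_minus[OF F1] DERIV_minus[OF F'] DERIV_minus[OF F1']
  have g': "t \<ge> 0 \<Longrightarrow> g t \<le> N * exp (c * t)" "t \<ge> 0 \<Longrightarrow> - g t \<le> N * exp (c * t)"
    "t \<ge> 0 \<Longrightarrow> g (- t) \<le> N * exp (c * t)" "t \<ge> 0 \<Longrightarrow> - g (- t) \<le> N * exp (c * t)" for t
    using g[of t] g[of "- t"] by auto
  have *: "s \<ge> 0 \<Longrightarrow> F s \<le> N * exp (c * s) / c\<^sup>2"
       "s \<ge> 0 \<Longrightarrow> - F s \<le> N * exp (c * s) / c\<^sup>2"
       "s \<ge> 0 \<Longrightarrow> F (- s) \<le> N * exp (c * s) / c\<^sup>2"
       "s \<ge> 0 \<Longrightarrow> - F (- s) \<le> N * exp (c * s) / c\<^sup>2" for s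
    using second_antiderivative_bound_right[OF F F1, of c N s]
      second_antiderivative_bound_right[OF mF(1,2), of c N s]
      second_antiderivative_bound_right[OF F' F1', of c N s]
      second_antiderivative_bound_right[OF mF(3,4), of c N s] assms g' by auto
  show ?thesis
    using *[of "\<bar>t\<bar>"] by (cases "t \<ge> 0") (auto simp: abs_le_iff)
qed

text \<open>Banach's fixed point theorem for the exponentially weighted supremum norm, which makes the
  Volterra operator a contraction on the whole line.\<close>

lemma second_order_ivp_exists:
  fixes h :: "real \<Rightarrow> real \<Rightarrow> real"
  assumes cont: "continuous_on UNIV (\<lambda>(t, x). h t x)"
    and bdd: "\<And>t x. \<bar>h t x\<bar> \<le> M"
    and lip: "\<And>t x y. \<bar>h t x - h t y\<bar> \<le> K * \<bar>x - y\<bar>"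
  shows "\<exists>y v. y 0 = \<alpha> \<and> v 0 = 0 \<and> (\<forall>t. (y has_real_derivative v t) (at t)
            \<and> (v has_real_derivative h t (y t)) (at t))"
proof -
  have "K \<ge> 0" using lip[of 0 1 0] abs_ge_zero[of "h 0 1 - h 0 0"] by simp
  have "M \<ge> 0" using bdd[of 0 0] by linarith
  \<comment> \<open>Two integrations gain 1 / c^2, so this choice makes the contraction factor K /
    c^2 at most 1/2.\<close>
  define c where "c = sqrt (2 * K + 1)"
  have c: "c > 0" "c\<^sup>2 = 2 * K + 1" using \<open>K \<ge> 0\<close> by (auto simp: c_def)
  obtain P where P: "\<And>f. continuous_on UNIV f \<Longrightarrow> P f 0 = (0::real)"
      "\<And>f t. continuous_on UNIV f \<Longrightarrow> (P f has_real_derivative f t) (at t)"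
    using antiderivative_exists by metis
  have cP: "continuous_on UNIV (P f)" if "continuous_on UNIV f" for f
    using P(2)[OF that] by (meson DERIV_isCont continuous_at_imp_continuous_on)
  \<comment> \<open>The unknown z is the weighted deviation exp (- c |t|) (y - \<alpha>), a bounded
    continuous function; \<open>Y\<close> removes the weight.\<close>
  define Y where "Y z t = \<alpha> + exp (c * \<bar>t\<bar>) * apply_bcontfun z t" for z t
  define g where "g z t = h t (Y z t)" for z t
  have cY: "continuous_on UNIV (Y z)" for z
    unfolding Y_def by (intro continuous_intros continuous_on_apply_bcontfun) 
  have cg: "continuous_on UNIV (g z)" for z
  proof -
    have "continuous_on UNIV ((\<lambda>(t, x). h t x) \<circ> (\<lambda>t. (t, Y z t)))"
      by (intro continuous_on_compose continuous_intros cY continuous_on_subset[OF cont]) auto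
    then show ?thesis by (simp add: o_def g_def)
  qed
  define Q where "Q z = P (P (g z))" for z
  have Q0: "Q z 0 = 0" "P (g z) 0 = 0" for z by (simp_all add: Q_def P cP cg)
  have Q1: "(Q z has_real_derivative P (g z) t) (at t)" for z t
    unfolding Q_def by (intro P cP cg)
  have Q2: "(P (g z) has_real_derivative g z t) (at t)" for z t
    by (intro P cP cg)
  define A where "A z t = exp (- (c * \<bar>t\<bar>)) * Q z t" for z t
  have bA: "A z \<in> bcontfun" for z
  proof (rule bcontfun_normI)
    show "continuous_on UNIV (A z)"
      unfolding A_def Q_def by (intro continuous_intros cP cg)
    fix t
    have "\<bar>g z s\<bar> \<le> M * exp (c * \<bar>s\<bar>)" for s
    proof -
      have "M * 1 \<le> M * exp (c * \<bar>s\<bar>)" using \<open>M \<ge> 0\<close> c by (intro mult_left_mono) auto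
      then show ?thesis using bdd[of s "Y z s"] unfolding g_def by linarith
    qed
    from second_antiderivative_bound[OF Q1 Q2 Q0 c(1) \<open>M \<ge> 0\<close> this]
    have "\<bar>Q z t\<bar> \<le> M * exp (c * \<bar>t\<bar>) / c\<^sup>2" .
    then have "exp (- (c * \<bar>t\<bar>)) * \<bar>Q z t\<bar> \<le> exp (- (c * \<bar>t\<bar>)) * (M * exp (c * \<bar>t\<bar>) / c\<^sup>2)"
      by (intro mult_left_mono) auto
    also have "\<dots> = M / c\<^sup>2" by (simp add: exp_minus)
    finally show "norm (A z t) \<le> M / c\<^sup>2" by (simp add: A_def abs_mult)
  qed
  define T where "T z = Bcontfun (A z)" for z
  have T: "apply_bcontfun (T z) = A z" for z
    unfolding T_def by (simp add: Bcontfun_inverse bA)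
  have "\<exists>!z. T z = z"
  proof (rule banach_fix_type)
    show "0 \<le> (1/2::real)" "(1/2::real) < 1" by auto
    show "\<forall>x y. dist (T x) (T y) \<le> 1/2 * dist x y"
    proof (intro allI dist_bound)
      fix x y :: "real \<Rightarrow>\<^sub>C real" and t :: real
      let ?D = "dist x y"
      have "\<bar>g x s - g y s\<bar> \<le> (K * ?D) * exp (c * \<bar>s\<bar>)" for s
      proof -
        have "\<bar>g x s - g y s\<bar> \<le> K * \<bar>Y x s - Y y s\<bar>" unfolding g_def by (rule lip)
        also have "Y x s - Y y s = exp (c * \<bar>s\<bar>) * (apply_bcontfun x s - apply_bcontfun y s)"
          by (simp add: Y_def algebra_simps)
        also have "\<bar>\<dots>\<bar> = exp (c * \<bar>s\<bar>) * dist (apply_bcontfun x s) (apply_bcontfun y s)"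
          by (simp add: abs_mult dist_real_def)
        also have "K * \<dots> \<le> K * (exp (c * \<bar>s\<bar>) * ?D)"
          using \<open>K \<ge> 0\<close> dist_bounded[of x s y] by (intro mult_left_mono) auto
        finally show ?thesis by (simp add: mult_ac)
      qed
      from second_antiderivative_bound[OF DERIV_diff[OF Q1 Q1] DERIV_diff[OF Q2 Q2] _ _ c(1) _ this, of t]
      have "\<bar>Q x t - Q y t\<bar> \<le> (K * ?D) * exp (c * \<bar>t\<bar>) / c\<^sup>2"
        using \<open>K \<ge> 0\<close> Q0 by simp
      then have "exp (- (c * \<bar>t\<bar>)) * \<bar>Q x t - Q y t\<bar> \<le> exp (- (c * \<bar>t\<bar>)) * ((K * ?D) * exp (c * \<bar>t\<bar>) / c\<^sup>2)"
        by (intro mult_left_mono) auto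
      also have "\<dots> = (K / c\<^sup>2) * ?D" by (simp add: exp_minus)
      also have "\<dots> \<le> (1/2) * ?D"
        using \<open>K \<ge> 0\<close> by (intro mult_right_mono) (auto simp: c field_simps)
      also have "exp (- (c * \<bar>t\<bar>)) * \<bar>Q x t - Q y t\<bar> = dist (A x t) (A y t)"
        by (simp add: A_def dist_real_def right_diff_distrib[symmetric] abs_mult)
      finally show "dist (apply_bcontfun (T x) t) (apply_bcontfun (T y) t) \<le> 1/2 * dist x y"
        by (simp add: T)
    qed
  qed
  then obtain z where z: "T z = z" by blast
  have YQ: "Y z t = \<alpha> + Q z t" for t
  proof -
    have "apply_bcontfun z t = exp (- (c * \<bar>t\<bar>)) * Q z t"
      by (subst z[symmetric]) (simp add: T A_def)
    then show ?thesis by (simp add: Y_def exp_minus)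
  qed
  have "(Y z has_real_derivative P (g z) t) (at t)" for t
  proof -
    have "((\<lambda>t. \<alpha> + Q z t) has_real_derivative P (g z) t) (at t)"
      by (auto intro!: derivative_eq_intros Q1)
    then show ?thesis by (simp add: YQ[abs_def])
  qed
  moreover have "(P (g z) has_real_derivative h t (Y z t)) (at t)" for t
    using Q2[of z t] by (simp add: g_def)
  moreover have "Y z 0 = \<alpha>" by (simp add: YQ Q0)
  ultimately show ?thesis using Q0(2)[of z] by blast
qed

section \<open>Uniqueness for the cubic equation\<close>

lemma cubic_lipschitz:
  fixes x y :: real
  assumes "\<bar>x\<bar> \<le> R" "\<bar>y\<bar> \<le> R"
  shows "\<bar>(x^3 - lam * x) - (y^3 - lam * y)\<bar> \<le> (3 * R\<^sup>2 + \<bar>lam\<bar>) * \<bar>x - y\<bar>"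
proof -
  have sq: "x\<^sup>2 \<le> R\<^sup>2" "y\<^sup>2 \<le> R\<^sup>2" using assms by (auto simp: abs_le_square_iff[symmetric])
  have "\<bar>x * y\<bar> \<le> R\<^sup>2"
    using mult_mono[OF assms] assms by (auto simp: abs_mult power2_eq_square)
  then have "\<bar>x\<^sup>2 + x * y + y\<^sup>2 - lam\<bar> \<le> 3 * R\<^sup>2 + \<bar>lam\<bar>"
    using sq zero_le_power2[of x] zero_le_power2[of y] by linarith
  then have "\<bar>x\<^sup>2 + x * y + y\<^sup>2 - lam\<bar> * \<bar>x - y\<bar> \<le> (3 * R\<^sup>2 + \<bar>lam\<bar>) * \<bar>x - y\<bar>"
    by (rule mult_right_mono) simp
  moreover have "(x^3 - lam * x) - (y^3 - lam * y) = (x\<^sup>2 + x * y + y\<^sup>2 - lam) * (x - y)"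
    by (simp add: power2_eq_square power3_eq_cube algebra_simps)
  ultimately show ?thesis by (simp add: abs_mult)
qed

lemma ivp_solutionD:
  assumes "ivp_solution \<epsilon> lam \<alpha> I u" "\<epsilon> \<noteq> 0" "t \<in> I"
  shows "(u has_real_derivative deriv u t) (at t)"
    and "(deriv u has_real_derivative ((u t)^3 - lam * u t + cos t) / \<epsilon>\<^sup>2) (at t)"
proof -
  have *: "u differentiable (at t)" "deriv u differentiable (at t)"
    "\<epsilon>\<^sup>2 * deriv (deriv u) t = (u t)^3 - lam * u t + cos t"
    using assms by (auto simp: ivp_solution_def)
  show "(u has_real_derivative deriv u t) (at t)"
    using *(1) by (simp add: DERIV_deriv_iff_real_differentiable)
  have "deriv (deriv u) t = ((u t)^3 - lam * u t + cos t) / \<epsilon>\<^sup>2"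
    using *(3) assms(2) by (simp add: field_simps)
  then show "(deriv u has_real_derivative ((u t)^3 - lam * u t + cos t) / \<epsilon>\<^sup>2) (at t)"
    using *(2) by (metis DERIV_deriv_iff_real_differentiable)
qed

lemma ivp_solution_segment:
  assumes "ivp_solution \<epsilon> lam \<alpha> I u" "t \<in> I"
  shows "closed_segment 0 t \<subseteq> I"
  using assms closed_segment_subset[of 0 I t]
  by (auto simp: ivp_solution_def is_interval_convex)

lemma ivp_solution_unique:
  assumes "\<epsilon> \<noteq> 0"
    and u: "ivp_solution \<epsilon> lam \<alpha> I u" "t \<in> I"
    and w: "ivp_solution \<epsilon> lam \<alpha> J w" "t \<in> J"
  shows "u t = w t"
proof -
  let ?S = "closed_segment 0 t"
  have S: "?S \<subseteq> I" "?S \<subseteq> J" using ivp_solution_segment u w by auto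
  have "continuous_on ?S u" "continuous_on ?S w"
    using ivp_solutionD(1)[OF u(1) assms(1)] ivp_solutionD(1)[OF w(1) assms(1)] S
    by (meson DERIV_isCont continuous_at_imp_continuous_on subsetD)+
  \<comment> \<open>The cubic is only locally Lipschitz; a common bound for both solutions on the
    compact time segment provides a constant valid there.\<close>
  then have "bounded (u ` ?S \<union> w ` ?S)"
    by (auto intro!: compact_imp_bounded compact_continuous_image)
  then obtain R where R: "\<And>s. s \<in> ?S \<Longrightarrow> \<bar>u s\<bar> \<le> R" "\<And>s. s \<in> ?S \<Longrightarrow> \<bar>w s\<bar> \<le> R"
    unfolding bounded_iff by force
  define K where "K = (3 * R\<^sup>2 + \<bar>lam\<bar>) / \<epsilon>\<^sup>2"
  have "u t - w t = 0"
  proof (rule second_order_unique[where d = "\<lambda>t. u t - w t" and a = 0 and K = K and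
        ?d1.0 = "\<lambda>t. deriv u t - deriv w t" and
        ?d2.0 = "\<lambda>t. ((u t)^3 - lam * u t + cos t) / \<epsilon>\<^sup>2 - ((w t)^3 - lam * w t + cos t) / \<epsilon>\<^sup>2"])
    show "K \<ge> 0" by (simp add: K_def)
    fix s assume s: "s \<in> ?S"
    then have I: "s \<in> I" "s \<in> J" using S by auto
    show "((\<lambda>t. u t - w t) has_real_derivative deriv u s - deriv w s) (at s)"
      by (intro DERIV_diff ivp_solutionD(1)[OF u(1) assms(1) I(1)] ivp_solutionD(1)[OF w(1) assms(1) I(2)])
    show "((\<lambda>t. deriv u t - deriv w t) has_real_derivative
        ((u s)^3 - lam * u s + cos s) / \<epsilon>\<^sup>2 - ((w s)^3 - lam * w s + cos s) / \<epsilon>\<^sup>2) (at s)"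
      by (intro DERIV_diff ivp_solutionD(2)[OF u(1) assms(1) I(1)] ivp_solutionD(2)[OF w(1) assms(1) I(2)])
    have "\<bar>((u s)^3 - lam * u s + cos s) / \<epsilon>\<^sup>2 - ((w s)^3 - lam * w s + cos s) / \<epsilon>\<^sup>2\<bar>
        = \<bar>((u s)^3 - lam * u s) - ((w s)^3 - lam * w s)\<bar> / \<epsilon>\<^sup>2"
      by (simp add: diff_divide_distrib[symmetric])
    also have "\<dots> \<le> ((3 * R\<^sup>2 + \<bar>lam\<bar>) * \<bar>u s - w s\<bar>) / \<epsilon>\<^sup>2"
      by (intro divide_right_mono cubic_lipschitz R s) simp
    finally show "\<bar>((u s)^3 - lam * u s + cos s) / \<epsilon>\<^sup>2 - ((w s)^3 - lam * w s + cos s) / \<epsilon>\<^sup>2\<bar> \<le> K * \<bar>u s - w s\<bar>"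
      by (simp add: K_def)
  qed (use u w in \<open>auto simp: ivp_solution_def\<close>)
  then show ?thesis by simp
qed

lemma sol_eq:
  assumes "\<epsilon> \<noteq> 0" "ivp_solution \<epsilon> lam \<alpha> I u" "t \<in> I"
  shows "sol \<epsilon> lam \<alpha> t = u t"
  unfolding sol_def using assms ivp_solution_unique[OF assms(1)] by (intro the_equality) blast+

section \<open>The truncated equation\<close>

locale forced_duffing =
  fixes \<epsilon> lam b :: real
  assumes eps: "\<epsilon> > 0" and lam: "lam > lambda0" and b_pos: "b > 0"
    and b_big: "b^3 - lam * b - 1 > 0"
begin

definition r :: real where "r = sqrt (lam / 3)"

text \<open>The cut is at b + 1 and not at b, so that a trajectory slightly outside the strip still
  solves the original equation: the spike needs a solution on an open interval around its closed
  time interval.\<close>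

definition clip :: "real \<Rightarrow> real" where "clip x = max (- (b + 1)) (min (b + 1) x)"

definition G :: "real \<Rightarrow> real" where "G x = (clip x)^3 - lam * clip x"

definition acc :: "real \<Rightarrow> real \<Rightarrow> real" where "acc t x = (G x + cos t) / \<epsilon>\<^sup>2"

definition traj :: "(real \<Rightarrow> real) \<Rightarrow> (real \<Rightarrow> real) \<Rightarrow> bool" where
  "traj y v \<longleftrightarrow> (\<forall>t. (y has_real_derivative v t) (at t) \<and> (v has_real_derivative acc t (y t)) (at t))"

lemma trajD:
  assumes "traj y v"
  shows "(y has_real_derivative v t) (at t)" "(v has_real_derivative acc t (y t)) (at t)"
  using assms by (auto simp: traj_def)

lemma traj_cont: "traj y v \<Longrightarrow> continuous_on A y"
  by (meson trajD(1) DERIV_isCont continuous_at_imp_continuous_on)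

lemma lam_pos: "lam > 0"
  using lam unfolding lambda0_def by (smt (verit) divide_pos_pos powr_gt_zero)

lemma r_pos: "r > 0" and r_sq: "3 * r\<^sup>2 = lam"
  using lam_pos by (auto simp: r_def)

lemma lam_r: "lam * r = 3 * r^3"
proof -
  have "(3 * r\<^sup>2) * r = 3 * r^3" by (simp add: power2_eq_square power3_eq_cube)
  then show ?thesis by (simp only: r_sq)
qed

text \<open>From lam / 3 > 2^(-2/3) follows r > 2^(-1/3). As 2 r^3 is the value of the cubic at -r,
  this is how the bound on lam beats the forcing.\<close>

lemma r_cube: "2 * r^3 > 1"
proof -
  have "(2::real) powr (2/3) > 0" by simp
  then have "1 / 2 powr (2/3) < lam / 3"
    using lam by (simp add: lambda0_def field_simps)
  then have "sqrt (1 / 2 powr (2/3)) < r"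
    unfolding r_def by (rule real_sqrt_less_mono)
  moreover have "(1::real) / 2 powr (2/3) = (2 powr (-(1/3)))\<^sup>2"
    by (simp add: power2_eq_square powr_add[symmetric] powr_minus_divide)
  ultimately have "2 powr (-(1/3)) < r" by (simp add: real_sqrt_abs)
  then have "(2 powr (-(1/3)))^3 < r^3" by (intro power_strict_mono) auto
  moreover have "(2 powr (-(1/3)))^3 = (1/2::real)"
    by (subst powr_power) (simp_all add: powr_minus_divide)
  ultimately show ?thesis by simp
qed

lemma G_eq: "\<bar>x\<bar> \<le> b + 1 \<Longrightarrow> G x = x^3 - lam * x"
  by (auto simp: G_def clip_def)

lemma clip_bounds: "\<bar>clip x\<bar> \<le> b + 1"
  using b_pos by (auto simp: clip_def)

lemma clip_lipschitz: "\<bar>clip x - clip y\<bar> \<le> \<bar>x - y\<bar>"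
proof -
  have "0 \<le> clip v - clip u \<and> clip v - clip u \<le> v - u" if "u \<le> v" for u v
    using that b_pos by (auto simp: clip_def min_def max_def)
  from this[of x y] this[of y x] show ?thesis by linarith
qed

lemma clip_uminus: "clip (- x) = - clip x"
  using b_pos by (auto simp: clip_def min_def max_def)

lemma G_uminus: "G (- x) = - G x"
  by (simp add: G_def clip_uminus)

definition Lip :: real where "Lip = 3 * (b + 1)\<^sup>2 + \<bar>lam\<bar>"

lemma Lip_nonneg: "Lip \<ge> 0" by (simp add: Lip_def)

lemma G_lipschitz: "\<bar>G x - G y\<bar> \<le> Lip * \<bar>x - y\<bar>"
proof -
  have "\<bar>G x - G y\<bar> \<le> Lip * \<bar>clip x - clip y\<bar>"
    unfolding G_def Lip_def by (intro cubic_lipschitz clip_bounds)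
  also have "\<dots> \<le> Lip * \<bar>x - y\<bar>"
    by (intro mult_left_mono Lip_nonneg clip_lipschitz)
  finally show ?thesis .
qed

lemma G_bounded: "\<bar>G x\<bar> \<le> Lip * (b + 1)"
proof -
  have "\<bar>G x\<bar> = \<bar>((clip x)^3 - lam * clip x) - (0^3 - lam * 0)\<bar>" by (simp add: G_def)
  also have "\<dots> \<le> Lip * \<bar>clip x - 0\<bar>"
    unfolding Lip_def using b_pos by (intro cubic_lipschitz clip_bounds) auto
  also have "\<dots> \<le> Lip * (b + 1)"
    using clip_bounds by (intro mult_left_mono Lip_nonneg) auto
  finally show ?thesis .
qed

lemma acc_lipschitz: "\<bar>acc t x - acc t y\<bar> \<le> Lip / \<epsilon>\<^sup>2 * \<bar>x - y\<bar>"
proof -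
  have "\<bar>acc t x - acc t y\<bar> = \<bar>G x - G y\<bar> / \<epsilon>\<^sup>2"
    by (simp add: acc_def diff_divide_distrib[symmetric])
  also have "\<dots> \<le> (Lip * \<bar>x - y\<bar>) / \<epsilon>\<^sup>2"
    by (intro divide_right_mono G_lipschitz) simp
  finally show ?thesis by simp
qed

section \<open>Signs and monotonicity of the cubic\<close>

lemma b_gt_r: "r < b"
proof (rule ccontr)
  assume "\<not> r < b"
  then have "b\<^sup>2 \<le> r\<^sup>2" using b_pos by (intro power_mono) auto
  then have "b\<^sup>2 - lam \<le> 0" using r_sq zero_le_power2[of r] by linarith
  then have "b * (b\<^sup>2 - lam) \<le> 0" using b_pos by (simp add: mult_nonneg_nonpos)
  then show False using b_big by (simp add: power2_eq_square power3_eq_cube algebra_simps)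
qed

lemma cubic_ge_b: assumes "x \<ge> b" shows "x^3 - lam * x > 1"
proof -
  have "b * (b\<^sup>2 - lam) > 1" using b_big by (simp add: power2_eq_square power3_eq_cube algebra_simps)
  then have p: "b\<^sup>2 - lam > 0" using b_pos by (smt (verit) mult_nonneg_nonpos)
  have "b\<^sup>2 \<le> x\<^sup>2" using assms b_pos by (intro power_mono) auto
  then have "b * (b\<^sup>2 - lam) \<le> x * (x\<^sup>2 - lam)"
    using assms b_pos p by (intro mult_mono) auto
  then show ?thesis
    using \<open>b * (b\<^sup>2 - lam) > 1\<close> by (simp add: power2_eq_square power3_eq_cube algebra_simps)
qed

lemma G_ge_b: assumes "x \<ge> b" shows "G x > 1"
  unfolding G_def using assms b_pos by (intro cubic_ge_b) (auto simp: clip_def)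

lemma acc_pos: "x \<ge> b \<Longrightarrow> acc t x > 0"
proof -
  assume "x \<ge> b"
  then have "G x + cos t > 0" using G_ge_b[of x] cos_ge_minus_one[of t] by linarith
  then show ?thesis using eps by (simp add: acc_def)
qed

text \<open>The difference quotient is x^2 + x y + y^2 - 3 r^2, and each of the three products is at
  least r^2 for points at or left of -r.\<close>

lemma cubic_strict_mono:
  assumes "x < y" "y \<le> - r" shows "x^3 - lam * x < y^3 - lam * y"
proof -
  have "r * r \<le> (- y) * (- y)" "r * r < (- x) * (- x)" "r * r \<le> (- x) * (- y)"
    using mult_mono[of r "- y" r "- y"] mult_strict_mono[of r "- x" r "- x"] mult_mono[of r "- x" r "- y"]
      assms r_pos by auto
  then have "x * x + x * y + y * y - 3 * (r * r) > 0" by simp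
  then have "(y - x) * (x * x + x * y + y * y - 3 * (r * r)) > 0" using assms by simp
  then show ?thesis using r_sq
    by (simp add: power2_eq_square power3_eq_cube algebra_simps)
qed

lemma G_strict_mono: "- (b + 1) \<le> x \<Longrightarrow> x < y \<Longrightarrow> y \<le> - r \<Longrightarrow> G x < G y"
  using cubic_strict_mono[of x y] r_pos b_pos by (simp add: G_eq)

text \<open>Only weak monotonicity: below -(b + 1) the truncated cubic is constant.\<close>

lemma G_mono: assumes "x \<le> y" "y \<le> - r" shows "G x \<le> G y"
proof -
  have "clip x \<le> clip y" "clip y \<le> - r"
    using assms b_gt_r b_pos r_pos by (auto simp: clip_def)
  then show ?thesis
    using cubic_strict_mono[of "clip x" "clip y"] by (cases "clip x = clip y") (auto simp: G_def)
qed

lemma G_minus_r: "G (- r) > 1"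
proof -
  have "G (- r) = 2 * r^3"
    using b_gt_r r_pos lam_r by (simp add: G_eq)
  then show ?thesis using r_cube by simp
qed

lemma acc_minus_r: "acc t (- r) > 0"
proof -
  have "G (- r) + cos t > 0" using G_minus_r cos_ge_minus_one[of t] by linarith
  then show ?thesis using eps by (simp add: acc_def)
qed

text \<open>The cubic plus 1 changes sign between -b and -r, and it increases strictly up to -r, so
  the root found there is the least one.\<close>

lemma alpha0: "- b < alpha0 lam" "alpha0 lam < - r" "G (alpha0 lam) = - 1"
proof -
  let ?f = "\<lambda>x. x^3 - lam * x + 1"
  have "?f (- b) < 0" using b_big by simp
  moreover have fr: "?f (- r) > 0"
    using r_cube r_pos lam_r by simp
  moreover have "continuous_on {- b..- r} ?f" by (intro continuous_intros)
  ultimately obtain x where x: "- b \<le> x" "x \<le> - r" "?f x = 0"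
    using IVT'[of ?f "- b" 0 "- r"] b_gt_r by auto
  have "x \<noteq> - b" "x \<noteq> - r" using x \<open>?f (- b) < 0\<close> fr by auto
  have "alpha0 lam = x"
    unfolding alpha0_def
  proof (rule Least_equality)
    fix y assume "?f y = 0"
    then show "x \<le> y" using x cubic_strict_mono[of y x] by (smt (verit))
  qed (use x in simp)
  then show "- b < alpha0 lam" "alpha0 lam < - r" "G (alpha0 lam) = - 1"
    using x \<open>x \<noteq> - b\<close> \<open>x \<noteq> - r\<close> r_pos by (auto simp: G_eq)
qed

section \<open>Symmetries, comparison of trajectories and exit from the strip\<close>

lemma traj_flip:
  assumes "traj y v" shows "traj (\<lambda>t. - y (t + pi)) (\<lambda>t. - v (t + pi))"
  unfolding traj_def
proof (intro allI conjI)
  fix t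
  show "((\<lambda>t. - y (t + pi)) has_real_derivative - v (t + pi)) (at t)"
    using DERIV_minus[OF trajD(1)[OF assms, of "t + pi", unfolded DERIV_shift]] .
  have "((\<lambda>t. - v (t + pi)) has_real_derivative - acc (t + pi) (y (t + pi))) (at t)"
    using DERIV_minus[OF trajD(2)[OF assms, of "t + pi", unfolded DERIV_shift]] .
  moreover have "- acc (t + pi) (y (t + pi)) = acc t (- y (t + pi))"
    using eps by (simp add: acc_def G_uminus field_simps)
  ultimately show "((\<lambda>t. - v (t + pi)) has_real_derivative acc t (- y (t + pi))) (at t)" by simp
qed

lemma traj_reflect:
  assumes "traj y v" shows "traj (\<lambda>t. y (- t)) (\<lambda>t. - v (- t))"
  unfolding traj_def
proof (intro allI conjI)
  fix t
  show "((\<lambda>t. y (- t)) has_real_derivative - v (- t)) (at t)"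
    using trajD(1)[OF assms, of "- t"] by (simp add: DERIV_mirror)
  have "((\<lambda>t. v (- t)) has_real_derivative - acc (- t) (y (- t))) (at t)"
    using trajD(2)[OF assms, of "- t"] by (simp add: DERIV_mirror)
  from DERIV_minus[OF this]
  show "((\<lambda>t. - v (- t)) has_real_derivative acc t (y (- t))) (at t)" by (simp add: acc_def)
qed

lemma traj_unique:
  assumes "traj y v" "traj y' v'" "y a = y' a" "v a = v' a"
  shows "y t = y' t"
proof -
  have "y t - y' t = 0"
    by (rule second_order_unique[where d = "\<lambda>t. y t - y' t" and a = a and
          ?d1.0 = "\<lambda>t. v t - v' t" and ?d2.0 = "\<lambda>t. acc t (y t) - acc t (y' t)" and K = "Lip / \<epsilon>\<^sup>2"])
      (auto intro!: DERIV_diff trajD[OF assms(1)] trajD[OF assms(2)] acc_lipschitz divide_nonneg_nonneg Lip_nonneg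
        simp: assms simp del: times_divide_eq_left)
  then show ?thesis by simp
qed

lemma traj_dependence:
  assumes "traj y v" "traj y' v'" "t \<ge> 0"
  shows "(y t - y' t)\<^sup>2 \<le> ((y 0 - y' 0)\<^sup>2 + (v 0 - v' 0)\<^sup>2) * exp ((1 + Lip / \<epsilon>\<^sup>2) * t)"
proof -
  have "(y t - y' t)\<^sup>2 + (v t - v' t)\<^sup>2
      \<le> ((y 0 - y' 0)\<^sup>2 + (v 0 - v' 0)\<^sup>2) * exp ((1 + Lip / \<epsilon>\<^sup>2) * (t - 0))"
    by (rule second_order_gronwall[where ?d2.0 = "\<lambda>t. acc t (y t) - acc t (y' t)"])
      (auto intro!: DERIV_diff trajD[OF assms(1)] trajD[OF assms(2)] acc_lipschitz divide_nonneg_nonneg Lip_nonneg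
        simp: assms simp del: times_divide_eq_left)
  then show ?thesis using zero_le_power2[of "v t - v' t"] by (simp only: diff_0_right)
qed

text \<open>Above b the acceleration is positive whatever the phase of the forcing. As the initial
  velocity may vanish, the argument rests on immediate increase (\<open>loc\<close>) and not on the
  sign of the velocity.\<close>

lemma traj_outward:
  assumes "traj y v" "y t0 \<ge> b" "v t0 \<ge> 0" "t0 < t"
  shows "y t > b"
proof -
  have loc: "\<exists>e>0. \<forall>h>0. h < e \<longrightarrow> y (s + h) > y s" if s: "y s \<ge> b" "v s \<ge> 0" for s
  proof -
    obtain e where e: "e > 0" "\<And>h. 0 < h \<Longrightarrow> h < e \<Longrightarrow> v s < v (s + h)"
      using DERIV_pos_inc_right[OF trajD(2)[OF assms(1)] acc_pos[OF s(1)]] by blast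
    have "y (s + h) > y s" if "0 < h" "h < e" for h
    proof (rule DERIV_pos_imp_increasing_open[of s "s + h" y])
      fix x assume "s < x" "x < s + h"
      then have "v x > 0" using e(2)[of "x - s"] s(2) that by auto
      then show "\<exists>z. (y has_real_derivative z) (at x) \<and> z > 0" using trajD(1)[OF assms(1)] by blast
    qed (use that traj_cont[OF assms(1)] in auto)
    then show ?thesis using e(1) by blast
  qed
  have ge: "y s \<ge> b" if "s \<ge> t0" for s
  proof (rule ccontr)
    assume "\<not> y s \<ge> b"
    define S where "S = {x. t0 \<le> x \<and> y x < b}"
    have ne: "S \<noteq> {}" "bdd_below S" using \<open>\<not> y s \<ge> b\<close> that by (auto simp: S_def bdd_below_def)
    \<comment> \<open>At the infimum of the times below b the trajectory is still at least b with
      nonnegative velocity, so it rises right afterwards and the infimum cannot be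
      approached.\<close>
    define m where "m = Inf S"
    have m: "t0 \<le> m" using ne unfolding m_def S_def by (intro cInf_greatest) auto
    have below: "y x \<ge> b" if "t0 \<le> x" "x < m" for x
    proof (rule ccontr)
      assume "\<not> y x \<ge> b"
      then have "x \<in> S" using that by (simp add: S_def)
      from cInf_lower[OF this ne(2)] show False using that by (simp add: m_def)
    qed
    have ym: "y m \<ge> b"
    proof (cases "m = t0")
      case False
      have "m \<in> closure {t0<..<m}" using False m by simp
      then show ?thesis
        using continuous_ge_on_closure[of "{t0<..<m}" y m b] traj_cont[OF assms(1)] below by auto
    qed (use assms in simp)
    have "v t0 \<le> v m"
      by (rule DERIV_nonneg_imp_nondecreasing[OF m])
        (metis order_le_less below ym trajD(2)[OF assms(1)] acc_pos)
    then have "v m \<ge> 0" using assms by simp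
    then obtain e where e: "e > 0" "\<And>h. h > 0 \<Longrightarrow> h < e \<Longrightarrow> y (m + h) > y m" using loc ym by blast
    obtain x where "x \<in> S" "x < m + e"
      using cInf_lessD[of S "m + e"] ne e unfolding m_def by auto
    moreover have "m \<le> x" using cInf_lower[OF \<open>x \<in> S\<close>] ne unfolding m_def by simp
    ultimately have "y x \<ge> b" using e(2)[of "x - m"] ym by (cases "x = m") auto
    then show False using \<open>x \<in> S\<close> by (simp add: S_def)
  qed
  have v: "v s > 0" if "s > t0" for s
  proof -
    have "v t0 < v s"
      by (rule DERIV_pos_imp_increasing[OF that]) (use ge trajD(2)[OF assms(1)] acc_pos in blast)
    then show ?thesis using assms by simp
  qed
  have "y t0 < y t"
  proof (rule DERIV_pos_imp_increasing_open[OF \<open>t0 < t\<close>])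
    fix x assume "t0 < x"
    then show "\<exists>z. (y has_real_derivative z) (at x) \<and> 0 < z"
      using trajD(1)[OF assms(1)] v by blast
  qed (rule traj_cont[OF assms(1)])
  then show ?thesis using assms by simp
qed

text \<open>When b is first reached from below, the velocity cannot be negative, so the outward
  motion starts there. Often used in contrapositive form: being in the strip at a later time
  excludes an earlier exit.\<close>

lemma stick_up:
  assumes "traj y v" "y t0 < b" "t0 \<le> t1" "t1 < t2" "y t1 \<ge> b"
  shows "y t2 > b"
proof -
  have "t0 \<le> t1" using assms by simp
  then obtain s where st: "t0 < s" "s \<le> t1" "y s = b"
    and below: "\<And>x. t0 \<le> x \<Longrightarrow> x < s \<Longrightarrow> y x < b"
    using first_hit[OF traj_cont[OF assms(1)]] assms by metis
  have "v s \<ge> 0"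
  proof (rule ccontr)
    assume "\<not> v s \<ge> 0"
    then obtain e where "e > 0" "\<And>h. h > 0 \<Longrightarrow> h < e \<Longrightarrow> y (s - h) > y s"
      using DERIV_neg_dec_left[OF trajD(1)[OF assms(1), of s]] by auto
    then have "y (s - min (e/2) (s - t0)) > y s" using st by (auto simp: min_def)
    moreover have "y (s - min (e/2) (s - t0)) < b"
      using st \<open>e > 0\<close> by (intro below) (auto simp: min_def)
    ultimately show False using st by simp
  qed
  then show ?thesis using traj_outward[OF assms(1), of s t2] st assms by simp
qed

lemma stick_down:
  assumes "traj y v" "y t0 > - b" "t0 \<le> t1" "t1 < t2" "y t1 \<le> - b"
  shows "y t2 < - b"
  using stick_up[OF traj_flip[OF assms(1)], of "t0 - pi" "t1 - pi" "t2 - pi"] assms by simp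

section \<open>The solution map of the truncated equation\<close>

lemma traj_exists: "\<exists>y v. traj y v \<and> y 0 = \<alpha> \<and> v 0 = 0"
proof -
  have "continuous_on UNIV (\<lambda>(t, x). acc t x)"
    unfolding acc_def G_def clip_def split_def using eps by (intro continuous_intros) auto
  moreover have "\<bar>acc t x\<bar> \<le> (Lip * (b + 1) + 1) / \<epsilon>\<^sup>2" for t x
  proof -
    have "\<bar>G x + cos t\<bar> \<le> Lip * (b + 1) + 1"
      using G_bounded[of x] abs_cos_le_one[of t] by linarith
    then show ?thesis by (simp add: acc_def divide_right_mono)
  qed
  ultimately show ?thesis
    using second_order_ivp_exists[of acc _ _ \<alpha>] acc_lipschitz unfolding traj_def by blast
qed

definition U :: "real \<Rightarrow> real \<Rightarrow> real" where
  "U \<alpha> = (SOME y. \<exists>v. traj y v \<and> y 0 = \<alpha> \<and> v 0 = 0)"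

lemma U_ex: "\<exists>v. traj (U \<alpha>) v \<and> U \<alpha> 0 = \<alpha> \<and> v 0 = 0"
  unfolding U_def by (rule someI_ex[OF traj_exists])

lemma U_0 [simp]: "U \<alpha> 0 = \<alpha>"
  using U_ex by blast

lemma U_even: "U \<alpha> (- t) = U \<alpha> t"
proof -
  obtain v where v: "traj (U \<alpha>) v" "v 0 = 0" using U_ex by blast
  show ?thesis using traj_unique[OF traj_reflect[OF v(1)] v(1), of 0 t] v by simp
qed

lemma U_abs: "U \<alpha> \<bar>t\<bar> = U \<alpha> t"
  using U_even[of \<alpha> t] by (cases "t \<ge> 0") auto

lemma U_lipschitz: "\<bar>U \<alpha> t - U \<beta> t\<bar> \<le> \<bar>\<alpha> - \<beta>\<bar> * exp ((1 + Lip / \<epsilon>\<^sup>2) * \<bar>t\<bar>)"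
proof -
  let ?c = "1 + Lip / \<epsilon>\<^sup>2"
  have c: "?c \<ge> 0" using Lip_nonneg by simp
  obtain v where v: "traj (U \<alpha>) v" "v 0 = 0" using U_ex by blast
  obtain w where w: "traj (U \<beta>) w" "w 0 = 0" using U_ex by blast
  have "(U \<alpha> \<bar>t\<bar> - U \<beta> \<bar>t\<bar>)\<^sup>2 \<le> (\<alpha> - \<beta>)\<^sup>2 * exp (?c * \<bar>t\<bar>)"
    using traj_dependence[OF v(1) w(1), of "\<bar>t\<bar>"] v w by simp
  \<comment> \<open>Weakening the factor to a square lets the root be taken without halving the
    exponent.\<close>
  also have "exp (?c * \<bar>t\<bar>) \<le> (exp (?c * \<bar>t\<bar>))\<^sup>2"
    using c by (intro self_le_power) auto
  finally have "(U \<alpha> t - U \<beta> t)\<^sup>2 \<le> (\<bar>\<alpha> - \<beta>\<bar> * exp (?c * \<bar>t\<bar>))\<^sup>2"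
    by (simp add: U_abs power_mult_distrib mult_left_mono)
  then show ?thesis by (intro power2_le_imp_le[of "\<bar>_\<bar>"]) auto
qed

text \<open>Joint continuity splits into the Lipschitz dependence on the parameter, uniform for
  bounded t, and continuity in t for the fixed parameter.\<close>

lemma continuous_U: "continuous_on UNIV (\<lambda>(\<alpha>, t). U \<alpha> t)"
proof -
  have "((\<lambda>(\<alpha>, t). U \<alpha> t) \<longlongrightarrow> U \<alpha>0 t0) (at (\<alpha>0, t0))" for \<alpha>0 t0
  proof -
    let ?F = "at (\<alpha>0, t0)"
    obtain v where v: "traj (U \<alpha>0) v" using U_ex by blast
    have a: "((\<lambda>p. fst p) \<longlongrightarrow> \<alpha>0) ?F" "((\<lambda>p. snd p) \<longlongrightarrow> t0) ?F"
      by (auto intro!: tendsto_eq_intros)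
    have c: "((\<lambda>p. U \<alpha>0 (snd p)) \<longlongrightarrow> U \<alpha>0 t0) ?F"
      using isCont_tendsto_compose[OF DERIV_isCont[OF trajD(1)[OF v]] a(2)] .
    have "((\<lambda>p. \<bar>fst p - \<alpha>0\<bar> * exp ((1 + Lip / \<epsilon>\<^sup>2) * \<bar>snd p\<bar>)) \<longlongrightarrow>
        \<bar>\<alpha>0 - \<alpha>0\<bar> * exp ((1 + Lip / \<epsilon>\<^sup>2) * \<bar>t0\<bar>)) ?F"
      by (intro tendsto_intros a)
    then have "((\<lambda>p. \<bar>fst p - \<alpha>0\<bar> * exp ((1 + Lip / \<epsilon>\<^sup>2) * \<bar>snd p\<bar>)) \<longlongrightarrow> 0) ?F"
      by simp
    moreover have "\<forall>\<^sub>F p in ?F. norm (U (fst p) (snd p) - U \<alpha>0 (snd p))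
        \<le> \<bar>fst p - \<alpha>0\<bar> * exp ((1 + Lip / \<epsilon>\<^sup>2) * \<bar>snd p\<bar>)"
      unfolding real_norm_def by (intro always_eventually allI U_lipschitz)
    ultimately have "((\<lambda>p. U (fst p) (snd p) - U \<alpha>0 (snd p)) \<longlongrightarrow> 0) ?F"
      by (rule Lim_null_comparison[rotated])
    from tendsto_add[OF this c] show ?thesis by (simp add: split_def)
  qed
  then show ?thesis by (auto simp: continuous_on_def split_def)
qed

section \<open>Transfer between truncated and original solutions\<close>

lemma ivp_solution_U:
  assumes "c > 0" "\<And>t. \<bar>t\<bar> < c \<Longrightarrow> \<bar>U \<alpha> t\<bar> \<le> b + 1"
  shows "ivp_solution \<epsilon> lam \<alpha> {-c<..<c} (U \<alpha>)"
proof -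
  obtain v where v: "traj (U \<alpha>) v" "v 0 = 0" using U_ex by blast
  have d: "deriv (U \<alpha>) = v" using trajD(1)[OF v(1)] by (auto intro!: DERIV_imp_deriv)
  show ?thesis
    unfolding ivp_solution_def
  proof (intro conjI ballI)
    fix t assume "t \<in> {-c<..<c}"
    then have b: "\<bar>U \<alpha> t\<bar> \<le> b + 1" using assms(2) by (auto simp: abs_less_iff)
    show "U \<alpha> differentiable at t" "deriv (U \<alpha>) differentiable at t"
      using trajD[OF v(1)] d real_differentiable_def by blast+
    have "deriv (deriv (U \<alpha>)) t = acc t (U \<alpha> t)"
      unfolding d by (rule DERIV_imp_deriv[OF trajD(2)[OF v(1)]])
    then show "\<epsilon>\<^sup>2 * deriv (deriv (U \<alpha>)) t = (U \<alpha> t)^3 - lam * U \<alpha> t + cos t"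
      using b eps by (simp add: acc_def G_eq)
  qed (use v d \<open>c > 0\<close> in \<open>auto simp: is_interval_oo\<close>)
qed

lemma ivp_solution_eq_U:
  assumes "ivp_solution \<epsilon> lam \<alpha> I u" "t \<in> I" "\<And>s. s \<in> closed_segment 0 t \<Longrightarrow> \<bar>u s\<bar> \<le> b + 1"
  shows "u t = U \<alpha> t"
proof -
  obtain v where v: "traj (U \<alpha>) v" "v 0 = 0" using U_ex by blast
  have "u t - U \<alpha> t = 0"
  proof (rule second_order_unique[where d = "\<lambda>t. u t - U \<alpha> t" and a = 0 and K = "Lip / \<epsilon>\<^sup>2" and
        ?d1.0 = "\<lambda>t. deriv u t - v t" and ?d2.0 = "\<lambda>t. acc t (u t) - acc t (U \<alpha> t)"])
    fix s assume s: "s \<in> closed_segment 0 t"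
    then have I: "s \<in> I" using ivp_solution_segment[OF assms(1,2)] by auto
    have "\<epsilon> \<noteq> 0" using eps by simp
    note D = ivp_solutionD[OF assms(1) this I]
    show "((\<lambda>t. u t - U \<alpha> t) has_real_derivative deriv u s - v s) (at s)"
      by (intro DERIV_diff D trajD[OF v(1)])
    have "(deriv u has_real_derivative acc s (u s)) (at s)"
      using D(2) assms(3)[OF s] by (simp add: acc_def G_eq)
    then show "((\<lambda>t. deriv u t - v t) has_real_derivative acc s (u s) - acc s (U \<alpha> s)) (at s)"
      by (intro DERIV_diff trajD[OF v(1)])
    show "\<bar>acc s (u s) - acc s (U \<alpha> s)\<bar> \<le> Lip / \<epsilon>\<^sup>2 * \<bar>u s - U \<alpha> s\<bar>" by (rule acc_lipschitz)
  qed (use assms v Lip_nonneg in \<open>auto simp: ivp_solution_def\<close>)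
  then show ?thesis by simp
qed

lemma global_solution:
  assumes "\<And>t. \<bar>U \<alpha> t\<bar> \<le> b"
  shows "max_interval \<epsilon> lam \<alpha> = UNIV" "sol \<epsilon> lam \<alpha> = U \<alpha>"
proof -
  have I: "ivp_solution \<epsilon> lam \<alpha> {-c<..<c} (U \<alpha>)" if "c > 0" for c
    using that assms by (intro ivp_solution_U) (auto intro: order_trans[of _ b])
  have m: "t \<in> {-(\<bar>t\<bar> + 1)<..<\<bar>t\<bar> + 1}" for t :: real by auto
  show "max_interval \<epsilon> lam \<alpha> = UNIV"
  proof (intro equalityI subsetI UNIV_I)
    fix t :: real
    show "t \<in> max_interval \<epsilon> lam \<alpha>"
      unfolding max_interval_def using I[of "\<bar>t\<bar> + 1"] m[of t]
      by (intro UnionI[of "{-(\<bar>t\<bar> + 1)<..<\<bar>t\<bar> + 1}"]) auto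
  qed
  show "sol \<epsilon> lam \<alpha> = U \<alpha>"
  proof
    fix t
    show "sol \<epsilon> lam \<alpha> t = U \<alpha> t"
      using eps by (intro sol_eq[OF _ I m]) auto
  qed
qed

end

section \<open>Spikes\<close>

text \<open>\<open>\<tau>\<close> is the time at which the monotone solution reaches b, hence the
  half-width of every spike. The sequence enters as a set of indices; the conditions on
  \<open>Sig\<close> encode positivity and the gap of two.\<close>

locale spike_pattern = forced_duffing +
  fixes abar \<tau> :: real and Sig :: "nat set"
  assumes abar_gt: "alpha0 lam < abar" and abar_lt: "abar < - sqrt (lam / 3)"
    and tau: "0 < \<tau>" "\<tau> < pi / 2"
    and ex: "{0..\<tau>} \<subseteq> max_interval \<epsilon> lam abar"
    and mono: "strict_mono_on {0..\<tau>} (sol \<epsilon> lam abar)"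
    and end_b: "sol \<epsilon> lam abar \<tau> = b"
    and Sig0: "0 \<notin> Sig" and Sig_gap: "n \<in> Sig \<Longrightarrow> Suc n \<notin> Sig"
begin

definition W :: "real \<Rightarrow> real" where "W = U abar"

lemma abar: "- b < abar" "abar < - r" "abar < 0" "abar < b"
proof -
  show "- b < abar" "abar < - r"
    using abar_gt abar_lt alpha0 by (auto simp: r_def)
  then show "abar < 0" "abar < b" using r_pos b_pos by linarith+
qed

lemma W_0 [simp]: "W 0 = abar" by (simp add: W_def)

lemma W_even: "W (- t) = W t" by (simp add: W_def U_even)

lemma W_traj: "\<exists>v. traj W v" using U_ex W_def by auto

lemma W_cont: "continuous_on A W"
  using W_traj traj_cont by blast

text \<open>Monotonicity traps the original solution between abar and b on this interval, where the
  truncation is inactive.\<close>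

lemma sol_eq_W:
  assumes "0 \<le> t" "t \<le> \<tau>" shows "sol \<epsilon> lam abar t = W t"
proof -
  have "\<tau> \<in> max_interval \<epsilon> lam abar" using ex tau by auto
  then obtain I u where u: "ivp_solution \<epsilon> lam abar I u" "\<tau> \<in> I"
    by (auto simp: max_interval_def)
  have I: "s \<in> I" if "0 \<le> s" "s \<le> \<tau>" for s
    using ivp_solution_segment[OF u] that by (auto simp: closed_segment_eq_real_ivl)
  have su: "sol \<epsilon> lam abar s = u s" if "0 \<le> s" "s \<le> \<tau>" for s
    using sol_eq[OF _ u(1) I[OF that]] eps by simp
  have u0: "u 0 = abar" using u by (simp add: ivp_solution_def)
  have "\<bar>u s\<bar> \<le> b + 1" if "0 \<le> s" "s \<le> \<tau>" for s
  proof -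
    have "u 0 \<le> u s" "u s \<le> u \<tau>"
      using strict_mono_on_leD[OF mono, of 0 s] strict_mono_on_leD[OF mono, of s \<tau>] that tau su by auto
    moreover have "u \<tau> = b" using su[of \<tau>] tau end_b by simp
    ultimately show ?thesis using u0 abar by auto
  qed
  then have "u t = U abar t"
    using assms by (intro ivp_solution_eq_U[OF u(1) I]) (auto simp: closed_segment_eq_real_ivl)
  then show ?thesis using su[OF assms] by (simp add: W_def)
qed

lemma W_tau [simp]: "W \<tau> = b" "W (- \<tau>) = b"
  using sol_eq_W[of \<tau>] tau end_b by (auto simp: W_even)

lemma W_strict_mono: "0 \<le> s \<Longrightarrow> s < t \<Longrightarrow> t \<le> \<tau> \<Longrightarrow> W s < W t"
  using strict_mono_onD[OF mono, of s t] by (simp add: sol_eq_W)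

lemma W_abs: "W \<bar>t\<bar> = W t"
  by (simp add: W_def U_abs)

lemma W_ge: "\<bar>t\<bar> \<le> \<tau> \<Longrightarrow> abar \<le> W t"
  using W_strict_mono[of 0 "\<bar>t\<bar>"] by (cases "t = 0") (auto simp: W_abs)

lemma W_le: "\<bar>t\<bar> \<le> \<tau> \<Longrightarrow> W t \<le> b"
  using W_strict_mono[of "\<bar>t\<bar>" \<tau>] by (cases "\<bar>t\<bar> = \<tau>") (auto simp: W_abs[of t, symmetric])

lemma W_out: assumes "\<tau> < \<bar>t\<bar>" shows "b < W t"
proof -
  obtain v where "traj W v" using W_traj by blast
  from stick_up[OF this, of 0 \<tau> "\<bar>t\<bar>"] show ?thesis using assms tau abar by (simp add: W_abs)
qed

text \<open>The corner times have to be interior times of a local solution, because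
  \<open>ivp_solution\<close> lives on open intervals; the margin in \<open>clip\<close> provides
  the room.\<close>

lemma W_solution_beyond:
  obtains d where "d > 0" "ivp_solution \<epsilon> lam abar {-(\<tau> + d)<..<\<tau> + d} W"
proof -
  obtain v where v: "traj W v" using W_traj by blast
  have "(W \<longlongrightarrow> W \<tau>) (at \<tau>)"
    using DERIV_isCont[OF trajD(1)[OF v]] by (simp only: isCont_def)
  then have "eventually (\<lambda>t. W t < b + 1) (at \<tau>)"
    by (rule order_tendstoD) simp
  then obtain d where d: "d > 0" "\<And>t. t \<noteq> \<tau> \<Longrightarrow> dist t \<tau> < d \<Longrightarrow> W t < b + 1"
    unfolding eventually_at by auto
  have "\<bar>U abar t\<bar> \<le> b + 1" if "\<bar>t\<bar> < \<tau> + d" for t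
  proof (cases "\<bar>t\<bar> \<le> \<tau>")
    case True
    then show ?thesis using W_ge[OF True] W_le[OF True] abar by (simp add: W_def)
  next
    case False
    then have "W \<bar>t\<bar> < b + 1" using d(2)[of "\<bar>t\<bar>"] that by (simp add: dist_real_def)
    then show ?thesis using W_out[of t] False b_pos by (simp add: W_abs) (simp add: W_def)
  qed
  then have "ivp_solution \<epsilon> lam abar {-(\<tau> + d)<..<\<tau> + d} W"
    using d tau unfolding W_def by (intro ivp_solution_U) auto
  then show ?thesis using that d by blast
qed

lemma spike_ext_eq:
  assumes "\<bar>t - of_int j * pi\<bar> \<le> \<tau>"
  shows "spike_ext \<epsilon> lam abar j t = (-1) powi j * W (t - of_int j * pi)"
proof -
  obtain d where d: "d > 0" "ivp_solution \<epsilon> lam abar {-(\<tau> + d)<..<\<tau> + d} W"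
    using W_solution_beyond by blast
  have "sol \<epsilon> lam abar (t - of_int j * pi) = W (t - of_int j * pi)"
    using assms eps d(1) by (intro sol_eq[OF _ d(2)]) (auto simp: abs_le_iff)
  then show ?thesis by (simp add: spike_ext_def)
qed

lemma abs_minus_one_powi: "\<bar>(-1) powi j :: real\<bar> = 1"
  by (cases "even j") (auto simp: power_int_minus_one_minus)

text \<open>Nothing is known about the original solution far from the spike. But just beyond
  \<open>\<tau>\<close> it agrees with \<open>W\<close> and exceeds b, and this gap already cuts off
  the component.\<close>

lemma spike_interval_eq:
  "spike_interval \<epsilon> lam b abar j = {of_int j * pi - \<tau>..of_int j * pi + \<tau>}" (is "?C = ?I")
proof -
  let ?c = "of_int j * pi"
  define S where "S = {t. t - ?c \<in> max_interval \<epsilon> lam abar \<and> \<bar>spike_ext \<epsilon> lam abar j t\<bar> \<le> b}"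
  obtain d where d: "d > 0" "ivp_solution \<epsilon> lam abar {-(\<tau> + d)<..<\<tau> + d} W"
    using W_solution_beyond by blast
  have C: "?C = connected_component_set S ?c" by (simp add: spike_interval_def S_def)
  have "?I \<subseteq> S"
  proof
    fix t assume "t \<in> ?I"
    then have t: "\<bar>t - ?c\<bar> \<le> \<tau>" by auto
    have "t - ?c \<in> {-(\<tau> + d)<..<\<tau> + d}" using t d(1) by auto
    then have "t - ?c \<in> max_interval \<epsilon> lam abar"
      unfolding max_interval_def using d(2) by blast
    moreover have "\<bar>spike_ext \<epsilon> lam abar j t\<bar> \<le> b"
      using W_ge[OF t] W_le[OF t] abar by (simp add: spike_ext_eq[OF t] abs_mult abs_minus_one_powi)
    ultimately show "t \<in> S" by (simp add: S_def)
  qed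
  moreover have "?c \<in> ?I" using tau by simp
  ultimately have sub1: "?I \<subseteq> ?C"
    unfolding C by (intro connected_component_maximal) auto
  have out: "?c + s \<notin> S" if "\<tau> < \<bar>s\<bar>" "\<bar>s\<bar> < \<tau> + d" for s
  proof -
    have "sol \<epsilon> lam abar s = W s"
      using eps that by (intro sol_eq[OF _ d(2)]) auto
    then have "\<bar>spike_ext \<epsilon> lam abar j (?c + s)\<bar> = \<bar>W s\<bar>"
      by (simp add: spike_ext_def abs_mult abs_minus_one_powi)
    then show ?thesis using W_out[OF that(1)] b_pos by (simp add: S_def)
  qed
  have conn: "connected ?C" "?C \<subseteq> S" "?c \<in> ?C"
    using connected_component_subset \<open>?c \<in> ?I\<close> sub1 unfolding C by (blast intro: connected_connected_component)+
  have "?C \<subseteq> ?I"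
  proof (rule ccontr)
    assume "\<not> ?C \<subseteq> ?I"
    then obtain y where y: "y \<in> ?C" "\<tau> < \<bar>y - ?c\<bar>" by force
    \<comment> \<open>A point of the component beyond \<open>\<tau>\<close> would force into it a
      point at distance e from the centre, which lies in the gap between \<open>\<tau>\<close> and
      \<open>\<tau> + d\<close>.\<close>
    define e where "e = min (\<bar>y - ?c\<bar>) (\<tau> + d / 2)"
    have e: "\<tau> < e" "e < \<tau> + d" "e \<le> \<bar>y - ?c\<bar>" using y d by (auto simp: e_def)
    show False
    proof (cases "y \<ge> ?c")
      case True
      then have "?c + e \<in> {?c..y}" using e tau by auto
      then have "?c + e \<in> S" using connected_contains_Icc[OF conn(1,3) y(1)] conn(2) by blast
      then show False using out[of e] e tau by auto
    next
      case False
      then have "?c + - e \<in> {y..?c}" using e tau by auto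
      then have "?c + - e \<in> S" using connected_contains_Icc[OF conn(1) y(1) conn(3)] conn(2) by blast
      then show False using out[of "- e"] e tau by auto
    qed
  qed
  then show ?thesis using sub1 by blast
qed

text \<open>\<open>Z m \<alpha>\<close> is the trajectory seen from the spike at \<open>m * pi\<close>, normalised by the symmetry
  \<open>(t, u) \<mapsto> (t + pi, -u)\<close>: in these coordinates every spike is \<open>W\<close>.\<close>

definition Z :: "nat \<Rightarrow> real \<Rightarrow> real \<Rightarrow> real" where
  "Z m \<alpha> t = (-1)^m * U \<alpha> (t + real m * pi)"

lemma Z_0 [simp]: "Z 0 = U" by (auto simp: Z_def fun_eq_iff)

lemma Z_Suc: "Z (Suc m) \<alpha> t = - Z m \<alpha> (t + pi)"
  by (simp add: Z_def algebra_simps)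

lemma Z_Suc_Suc: "Z (Suc (Suc m)) \<alpha> t = Z m \<alpha> (t + 2 * pi)"
  by (simp add: Z_Suc add.assoc)

lemma Z_traj: "\<exists>v. traj (Z m \<alpha>) v"
proof (induction m)
  case 0
  then show ?case using U_ex by auto
next
  case (Suc m)
  then obtain v where "traj (Z m \<alpha>) v" by blast
  from traj_flip[OF this] show ?case by (auto simp: Z_Suc[abs_def])
qed

lemma abs_Z: "\<bar>Z m \<alpha> t\<bar> = \<bar>U \<alpha> (t + real m * pi)\<bar>"
  by (simp add: Z_def abs_mult)

lemma Z_start: "\<alpha> \<in> {alpha0 lam..abar} \<Longrightarrow> \<bar>Z m \<alpha> (- (real m * pi))\<bar> < b"
  using alpha0(1) abar by (auto simp: abs_Z)

lemma Z_stick_up: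
  assumes "\<alpha> \<in> {alpha0 lam..abar}" "- (real m * pi) \<le> t1" "t1 < t2" "Z m \<alpha> t1 \<ge> b"
  shows "Z m \<alpha> t2 > b"
proof -
  obtain v where "traj (Z m \<alpha>) v" using Z_traj by blast
  from stick_up[OF this, of "- (real m * pi)" t1 t2] show ?thesis
    using Z_start[OF assms(1), of m] assms by auto
qed

lemma Z_stick_down:
  assumes "\<alpha> \<in> {alpha0 lam..abar}" "- (real m * pi) \<le> t1" "t1 < t2" "Z m \<alpha> t1 \<le> - b"
  shows "Z m \<alpha> t2 < - b"
proof -
  obtain v where "traj (Z m \<alpha>) v" using Z_traj by blast
  from stick_down[OF this, of "- (real m * pi)" t1 t2] show ?thesis
    using Z_start[OF assms(1), of m] assms by auto
qed

lemma continuous_Z [continuous_intros]: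
  assumes "continuous_on A f" "continuous_on A g"
  shows "continuous_on A (\<lambda>x. Z m (f x) (g x))"
proof -
  have "continuous_on A ((\<lambda>(\<alpha>, t). U \<alpha> t) \<circ> (\<lambda>x. (f x, g x + real m * pi)))"
    by (intro continuous_on_compose continuous_intros assms continuous_on_subset[OF continuous_U]) auto
  then show ?thesis unfolding Z_def by (intro continuous_intros) (simp add: o_def)
qed

lemma continuous_W [continuous_intros]:
  assumes "continuous_on A g" shows "continuous_on A (\<lambda>x. W (g x))"
  using continuous_on_compose[OF assms W_cont] by (simp add: o_def)

text \<open>An interior contact from below is a minimum of W - y, so the velocities agree as well
  and uniqueness gives coincidence for all times, also outside the spike.\<close>

lemma touch_spike:
  assumes "traj y v" "\<And>t. \<bar>t\<bar> \<le> \<tau> \<Longrightarrow> y t \<le> W t" "\<bar>s\<bar> < \<tau>" "y s = W s"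
  shows "y t = W t"
proof -
  obtain w where w: "traj W w" using W_traj by blast
  have "((\<lambda>t. W t - y t) has_real_derivative w s - v s) (at s)"
    by (intro DERIV_diff trajD(1)[OF w] trajD(1)[OF assms(1)])
  then have "w s - v s = 0"
  proof (rule DERIV_local_min[where d = "\<tau> - \<bar>s\<bar>"])
    show "\<forall>t. \<bar>s - t\<bar> < \<tau> - \<bar>s\<bar> \<longrightarrow> W s - y s \<le> W t - y t"
      using assms(2,4) by (auto simp: abs_less_iff)
  qed (use assms(3) in simp)
  then show ?thesis using traj_unique[OF assms(1) w assms(4)] by simp
qed

text \<open>On \<open>u < -r\<close> the nonlinearity increases, so \<open>W - y\<close> cannot have a nonpositive minimum there.\<close>

lemma below_spike:
  assumes y: "traj y v" and low: "\<And>t. \<bar>t\<bar> \<le> \<tau> \<Longrightarrow> y t < - r" and "\<bar>t\<bar> \<le> \<tau>"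
  shows "y t < W t"
proof -
  obtain w where w: "traj W w" using W_traj by blast
  let ?d = "\<lambda>t. W t - y t"
  have "\<exists>s\<in>{-\<tau>..\<tau>}. \<forall>t\<in>{-\<tau>..\<tau>}. ?d s \<le> ?d t"
    using tau by (intro continuous_attains_inf continuous_on_diff W_cont traj_cont[OF y]) auto
  then obtain s where s: "\<bar>s\<bar> \<le> \<tau>" "\<And>t. \<bar>t\<bar> \<le> \<tau> \<Longrightarrow> ?d s \<le> ?d t"
    by (metis abs_le_iff atLeastAtMost_iff minus_le_iff)
  have "?d s > 0"
  proof (rule ccontr)
    assume neg: "\<not> ?d s > 0"
    have "y s < b" using low[OF s(1)] r_pos b_pos by linarith
    then have "s \<noteq> \<tau>" "s \<noteq> - \<tau>" using neg by auto
    then have s': "\<bar>s\<bar> < \<tau>" using s(1) by linarith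
    have D: "(?d has_real_derivative w t - v t) (at t)" for t
      by (intro DERIV_diff trajD(1)[OF w] trajD(1)[OF y])
    have "w s - v s = 0"
      using D
    proof (rule DERIV_local_min[where d = "\<tau> - \<bar>s\<bar>"])
      show "\<forall>t. \<bar>s - t\<bar> < \<tau> - \<bar>s\<bar> \<longrightarrow> ?d s \<le> ?d t"
        using s(2) by (auto simp: abs_less_iff)
    qed (use s' in simp)
    show False
    proof (cases "?d s = 0")
      case True
      then have "y \<tau> = W \<tau>" using traj_unique[OF y w, of s] \<open>w s - v s = 0\<close> by simp
      then show False using low[of \<tau>] tau r_pos b_pos by simp
    next
      case False
      \<comment> \<open>Here abar <= W s < y s < -r, on the increasing branch, so W - y has a
        negative second derivative at its minimum.\<close>
      then have "G (W s) < G (y s)"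
        using neg W_ge[OF s(1)] low[OF s(1)] abar by (intro G_strict_mono) auto
      then have "acc s (W s) - acc s (y s) < 0"
        using eps by (simp add: acc_def divide_strict_right_mono)
      moreover have "((\<lambda>t. w t - v t) has_real_derivative acc s (W s) - acc s (y s)) (at s)"
        by (intro DERIV_diff trajD(2)[OF w] trajD(2)[OF y])
      ultimately obtain e where e: "e > 0" "\<And>h. 0 < h \<Longrightarrow> h < e \<Longrightarrow> w (s + h) - v (s + h) < 0"
        using DERIV_neg_dec_right[of "\<lambda>t. w t - v t" _ s] \<open>w s - v s = 0\<close> by force
      define h where "h = min (e / 2) (\<tau> - \<bar>s\<bar>)"
      have h: "0 < h" "h < e" "\<bar>s + h\<bar> \<le> \<tau>" using e s' by (auto simp: h_def min_def)
      have "?d (s + h) < ?d s"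
      proof (rule DERIV_neg_imp_decreasing_open[of s "s + h" ?d])
        fix x assume "s < x" "x < s + h"
        then have "w x - v x < 0" using e(2)[of "x - s"] h by auto
        then show "\<exists>z. (?d has_real_derivative z) (at x) \<and> z < 0" using D by blast
      qed (use h in \<open>auto intro!: continuous_on_diff W_cont traj_cont[OF y]\<close>)
      then show False using s(2)[OF h(3)] by simp
    qed
  qed
  then show ?thesis using s(2)[OF assms(3)] by simp
qed

section \<open>Shooting\<close>

definition hits :: "nat \<Rightarrow> real \<Rightarrow> bool" where
  "hits m \<alpha> \<longleftrightarrow> (\<exists>t. \<bar>t\<bar> \<le> \<tau> \<and> Z m \<alpha> t = W t)"

text \<open>The shooting invariant after spike \<open>m\<close>.  The ends \<open>p\<close> and \<open>q\<close> are in no particular order, since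
  the symmetry exchanges their roles from one spike to the next.  A lower bound on the exit times,
  growing with \<open>m\<close>, is what makes the limiting trajectory bounded.\<close>

definition shooting :: "nat \<Rightarrow> real \<Rightarrow> real \<Rightarrow> bool" where
  "shooting m p q \<longleftrightarrow>
     m \<notin> Sig \<and> p \<noteq> q \<and> closed_segment p q \<subseteq> {alpha0 lam..abar} \<and>
     (\<forall>\<alpha>\<in>closed_segment p q. \<forall>t. - (real m * pi) \<le> t \<and> t < - pi \<longrightarrow> \<bar>Z m \<alpha> t\<bar> < b) \<and>
     (\<exists>T\<ge>- pi. - (real m * pi) \<le> T \<and> Z m p T = - b \<and> (\<forall>t. 0 \<le> t \<and> t < T \<longrightarrow> - b < Z m p t \<and> Z m p t < - r)) \<and>
     Z m q \<tau> = b \<and>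
     (\<forall>\<alpha>\<in>open_segment p q. \<forall>t. \<bar>t\<bar> \<le> \<tau> \<longrightarrow> Z m \<alpha> t < W t) \<and>
     (\<forall>\<alpha>\<in>open_segment p q. \<forall>j. 1 \<le> j \<and> j < m \<longrightarrow> (hits j \<alpha> \<longleftrightarrow> j \<in> Sig))"

lemma shootingD:
  assumes "shooting m p q"
  shows "m \<notin> Sig" "p \<noteq> q" "closed_segment p q \<subseteq> {alpha0 lam..abar}"
    "\<And>\<alpha> t. \<alpha> \<in> closed_segment p q \<Longrightarrow> - (real m * pi) \<le> t \<Longrightarrow> t < - pi \<Longrightarrow> \<bar>Z m \<alpha> t\<bar> < b"
    "\<exists>T\<ge>- pi. - (real m * pi) \<le> T \<and> Z m p T = - b \<and> (\<forall>t. 0 \<le> t \<and> t < T \<longrightarrow> - b < Z m p t \<and> Z m p t < - r)"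
    "Z m q \<tau> = b"
    "\<And>\<alpha> t. \<alpha> \<in> open_segment p q \<Longrightarrow> \<bar>t\<bar> \<le> \<tau> \<Longrightarrow> Z m \<alpha> t < W t"
    "\<And>\<alpha> j. \<alpha> \<in> open_segment p q \<Longrightarrow> 1 \<le> j \<Longrightarrow> j < m \<Longrightarrow> hits j \<alpha> \<longleftrightarrow> j \<in> Sig"
  using assms unfolding shooting_def by blast+

lemma shooting_le_W:
  assumes "shooting m p q" "\<alpha> \<in> closed_segment p q" "\<bar>t\<bar> \<le> \<tau>"
  shows "Z m \<alpha> t \<le> W t"
  using shootingD(2,7)[OF assms(1)] assms(2,3)
  by (intro le_on_closed_segment[of "\<lambda>\<alpha>. Z m \<alpha> t" p q _ \<alpha>])
    (auto intro!: continuous_intros less_imp_le)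

text \<open>Before the exit the bound is part of the invariant; after it the trajectory is below -b
  for good. The exit time may be negative, as after a skipped spike, and then the second reason
  alone applies.\<close>

lemma shooting_exit_below:
  assumes "shooting m p q" "0 \<le> t"
  shows "Z m p t < - r"
proof -
  have p: "p \<in> {alpha0 lam..abar}" using shootingD(3)[OF assms(1)] by auto
  obtain T where T: "- (real m * pi) \<le> T" "Z m p T = - b"
      "\<And>t. 0 \<le> t \<Longrightarrow> t < T \<Longrightarrow> - b < Z m p t \<and> Z m p t < - r"
    using shootingD(5)[OF assms(1)] by blast
  show ?thesis
    using T(3)[of t] Z_stick_down[OF p T(1), of t] T(2) assms(2) b_gt_r
    by (cases t T rule: linorder_cases) auto
qed

lemma mem_tau: "t \<in> {-\<tau>..\<tau>} \<longleftrightarrow> \<bar>t\<bar> \<le> \<tau>"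
  by auto

lemma tau_pi: "\<tau> < pi - \<tau>"
  using tau by simp

text \<open>Parameters that meet the next spike or leave the strip to its left form a compact set
  containing \<open>p\<close> but not \<open>q\<close>; its point nearest to \<open>q\<close> runs into the right corner of that spike.\<close>

lemma shooting_skip:
  assumes st: "shooting m p q" and "Suc m \<notin> Sig"
  obtains y where "shooting (Suc m) q y" "closed_segment q y \<subseteq> closed_segment p q"
proof -
  note S = shootingD[OF st]
  define Y where "Y = {\<alpha> \<in> closed_segment p q. \<exists>t\<in>{-\<tau>..\<tau>}. 0 \<le> Z (Suc m) \<alpha> t - W t}"
  have Y: "\<alpha> \<in> Y \<longleftrightarrow> \<alpha> \<in> closed_segment p q \<and> (\<exists>t. \<bar>t\<bar> \<le> \<tau> \<and> W t \<le> Z (Suc m) \<alpha> t)" for \<alpha>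
    by (simp only: Y_def Bex_def diff_ge_0_iff_ge mem_tau mem_Collect_eq)
  have cY: "compact Y"
    unfolding Y_def using compact_exists_nonneg[of "\<lambda>x. Z (Suc m) (fst x) (snd x) - W (snd x)"]
    by (simp add: continuous_intros)
  \<comment> \<open>Seen from the next spike the sign is reversed: p passes above r at its centre,
    where \<open>W\<close> equals abar < 0.\<close>
  have "Z m p pi < - r" using shooting_exit_below[OF st] by simp
  then have "p \<in> Y" using abar r_pos tau by (auto simp: Y Z_Suc intro!: exI[of _ 0])
  \<comment> \<open>q leaves upwards at \<open>\<tau>\<close>, before the next spike opens at
    \<open>pi - \<tau>\<close>; after the sign change it is below -b throughout that spike.\<close>
  moreover have "q \<notin> Y"
  proof -
    have "Z (Suc m) q t < W t" if "\<bar>t\<bar> \<le> \<tau>" for t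
    proof -
      have "q \<in> {alpha0 lam..abar}" using S(3) by (rule subsetD) simp
      moreover have "- (real m * pi) \<le> \<tau>"
        using tau mult_nonneg_nonneg[of "real m" pi] pi_ge_zero by linarith
      moreover have "\<tau> < t + pi" using that tau_pi by linarith
      ultimately have "Z m q (t + pi) > b"
        using S(6) by (intro Z_stick_up[of q m \<tau> "t + pi"]) auto
      then show ?thesis using W_ge[OF that] abar by (simp add: Z_Suc)
    qed
    then show ?thesis by (force simp: Y)
  qed
  ultimately obtain y where y: "y \<in> Y" "y \<noteq> q"
      "\<And>\<alpha>. \<alpha> \<in> closed_segment q y \<Longrightarrow> \<alpha> \<noteq> y \<Longrightarrow> \<alpha> \<notin> Y"
    using closest_in_segment[OF cY, of q p] Y by (metis closed_segment_commute empty_iff subsetI)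
  have sub: "closed_segment q y \<subseteq> closed_segment p q"
    using y(1) by (simp add: Y subset_closed_segment)
  have N: "Z (Suc m) \<alpha> t < W t" if "\<alpha> \<in> closed_segment q y" "\<alpha> \<noteq> y" "\<bar>t\<bar> \<le> \<tau>" for \<alpha> t
    using y(3)[OF that(1,2)] sub that by (force simp: Y)
  have N': "Z (Suc m) \<alpha> t \<le> W t" if "\<alpha> \<in> closed_segment q y" "\<bar>t\<bar> \<le> \<tau>" for \<alpha> t
    using y(2) that N
    by (intro le_on_closed_segment[of "\<lambda>\<alpha>. Z (Suc m) \<alpha> t" q y _ \<alpha>])
      (auto intro!: continuous_intros less_imp_le simp: open_segment_def)
  have y_in: "y \<in> {alpha0 lam..abar}" using sub S(3) by auto
  have Zy: "Z (Suc m) y \<tau> = b"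
  proof -
    obtain s where s: "\<bar>s\<bar> \<le> \<tau>" "Z (Suc m) y s = W s"
      using y(1) N'[of y] by (force simp: Y)
    have start: "- (real (Suc m) * pi) \<le> - pi" by (simp add: algebra_simps)
    have "\<not> \<bar>s\<bar> < \<tau>"
    proof
      assume "\<bar>s\<bar> < \<tau>"
      obtain v where "traj (Z (Suc m) y) v" using Z_traj by blast
      from touch_spike[OF this N'[of y] \<open>\<bar>s\<bar> < \<tau>\<close> s(2)] have eq: "Z (Suc m) y t = W t" for t by simp
      \<comment> \<open>Coincidence with \<open>W\<close> would put the trajectory above b already
        at time -pi, hence still above b at the left corner, where \<open>W\<close> is just
        b.\<close>
      have "Z (Suc m) y (- \<tau>) > b"
        using Z_stick_up[OF y_in start, of "- \<tau>"] W_out[of "- pi"] tau by (simp add: eq)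
      then show False by (simp add: eq)
    qed
    \<comment> \<open>Meeting the left corner means leaving the strip there and passing strictly
      above the right corner, against \<open>N'\<close>.\<close>
    moreover have "s \<noteq> - \<tau>"
    proof
      assume "s = - \<tau>"
      moreover have "- (real (Suc m) * pi) \<le> - \<tau>" using start tau by linarith
      ultimately have "Z (Suc m) y \<tau> > b"
        using Z_stick_up[OF y_in, of "Suc m" "- \<tau>" \<tau>] s tau by simp
      then show False using N'[of y \<tau>] tau by simp
    qed
    ultimately show ?thesis using s by (cases "s = \<tau>") auto
  qed
  have "shooting (Suc m) q y"
    unfolding shooting_def
  proof (intro conjI ballI allI impI)
    show "closed_segment q y \<subseteq> {alpha0 lam..abar}" using sub S(3) by blast
    show "\<bar>Z (Suc m) \<alpha> t\<bar> < b"
      if \<alpha>: "\<alpha> \<in> closed_segment q y" and t: "- (real (Suc m) * pi) \<le> t \<and> t < - pi" for \<alpha> t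
    proof -
      have \<alpha>': "\<alpha> \<in> closed_segment p q" "\<alpha> \<in> {alpha0 lam..abar}" using \<alpha> sub S(3) by auto
      have t': "- (real m * pi) \<le> t + pi" "t + pi < 0" using t by (auto simp: algebra_simps)
      \<comment> \<open>An exit before time 0 would persist: the old spike excludes one through the
        top by its bound at \<open>\<tau>\<close>, the new one excludes one through the bottom by
        its bound at \<open>pi - \<tau>\<close>.\<close>
      have "Z m \<alpha> \<tau> \<le> b" using shooting_le_W[OF st \<alpha>'(1), of \<tau>] tau by simp
      then have "Z m \<alpha> (t + pi) < b"
        using Z_stick_up[OF \<alpha>'(2) t'(1), of \<tau>] t' tau by fastforce
      moreover have "Z (Suc m) \<alpha> (- \<tau>) \<le> b" using N'[OF \<alpha>, of "- \<tau>"] tau by simp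
      then have "Z m \<alpha> (t + pi) > - b"
        using Z_stick_down[OF \<alpha>'(2) t'(1), of "pi - \<tau>"] t' tau by (fastforce simp: Z_Suc)
      ultimately show ?thesis by (simp add: Z_Suc)
    qed
    show "\<exists>T\<ge>- pi. - (real (Suc m) * pi) \<le> T \<and> Z (Suc m) q T = - b
        \<and> (\<forall>t. 0 \<le> t \<and> t < T \<longrightarrow> - b < Z (Suc m) q t \<and> Z (Suc m) q t < - r)"
    \<comment> \<open>The upward exit of q at \<open>\<tau>\<close> becomes, after the flip, a
      downward exit at this time; as it is negative, the condition on [0, T) is vacuous.\<close>
    proof (intro exI[of _ "\<tau> - pi"] conjI allI impI)
      have "real m * pi \<ge> 0" by simp
      then show "- (real (Suc m) * pi) \<le> \<tau> - pi"
        using tau by (simp add: distrib_right, linarith)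
    qed (use S(6) tau in \<open>auto simp: Z_Suc\<close>)
    show "Z (Suc m) \<alpha> t < W t" if "\<alpha> \<in> open_segment q y" "\<bar>t\<bar> \<le> \<tau>" for \<alpha> t
      using N that by (auto simp: open_segment_def)
    show "hits j \<alpha> \<longleftrightarrow> j \<in> Sig" if \<alpha>: "\<alpha> \<in> open_segment q y" and j: "1 \<le> j \<and> j < Suc m" for \<alpha> j
    proof -
      have "\<alpha> \<noteq> p" using \<alpha> y(3)[of \<alpha>] \<open>p \<in> Y\<close> by (auto simp: open_segment_def)
      then have o: "\<alpha> \<in> open_segment p q" using \<alpha> sub by (auto simp: open_segment_def)
      show ?thesis
      proof (cases "j = m")
        case True
        then show ?thesis using S(1) S(7)[OF o] by (force simp: hits_def)
      qed (use S(8)[OF o] j in auto)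
    qed
  qed (use assms y Zy in auto)
  then show ?thesis using that sub by blast
qed

text \<open>Trajectories that stay in \<open>u < -r\<close> until the next spike of the same orientation, two spikes
  later, must cross the intermediate one, which points the other way.\<close>

lemma shooting_cross:
  assumes st: "shooting m p q" and "Suc m \<in> Sig"
  obtains p' y where "shooting (Suc (Suc m)) p' y" "closed_segment p' y \<subseteq> closed_segment p q"
proof -
  note S = shootingD[OF st]
  let ?m = "Suc (Suc m)"
  \<comment> \<open>Two ways to fail on the way to spike m + 2, which is 2 pi later: reaching -r, or
    not staying below that spike.\<close>
  define Y1 where "Y1 = {\<alpha> \<in> closed_segment p q. \<exists>t\<in>{0..2 * pi}. 0 \<le> Z m \<alpha> t - (- r)}"
  define Y2 where "Y2 = {\<alpha> \<in> closed_segment p q. \<exists>t\<in>{-\<tau>..\<tau>}. 0 \<le> Z ?m \<alpha> t - W t}"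
  have Y1: "\<alpha> \<in> Y1 \<longleftrightarrow> \<alpha> \<in> closed_segment p q \<and> (\<exists>t. 0 \<le> t \<and> t \<le> 2 * pi \<and> - r \<le> Z m \<alpha> t)" for \<alpha>
    by (simp only: Y1_def Bex_def diff_ge_0_iff_ge atLeastAtMost_iff mem_Collect_eq conj_assoc)
  have Y2: "\<alpha> \<in> Y2 \<longleftrightarrow> \<alpha> \<in> closed_segment p q \<and> (\<exists>t. \<bar>t\<bar> \<le> \<tau> \<and> W t \<le> Z ?m \<alpha> t)" for \<alpha>
    by (simp only: Y2_def Bex_def diff_ge_0_iff_ge mem_tau mem_Collect_eq)
  have "compact Y1" "compact Y2"
    unfolding Y1_def Y2_def using compact_exists_nonneg[of "\<lambda>x. Z m (fst x) (snd x) - (- r)"]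
      compact_exists_nonneg[of "\<lambda>x. Z ?m (fst x) (snd x) - W (snd x)"]
    by (simp_all add: continuous_intros)
  then have cY: "compact (Y1 \<union> Y2)" by (rule compact_Un)
  have qY: "q \<in> Y1" using S(6) tau tau_pi r_pos b_pos by (auto simp: Y1 intro!: exI[of _ \<tau>])
  moreover have pY: "p \<notin> Y1 \<union> Y2"
  proof -
    obtain v where v: "traj (Z ?m p) v" using Z_traj by blast
    have low: "Z ?m p t < - r" if "\<bar>t\<bar> \<le> \<tau>" for t
      unfolding Z_Suc_Suc using that tau tau_pi by (intro shooting_exit_below[OF st]) auto
    then have "Z ?m p t < W t" if "\<bar>t\<bar> \<le> \<tau>" for t
      using below_spike[OF v] that by blast
    then show ?thesis using shooting_exit_below[OF st] by (force simp: Y1 Y2)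
  qed
  ultimately obtain y where y: "y \<in> Y1 \<union> Y2" "y \<noteq> p"
      "\<And>\<alpha>. \<alpha> \<in> closed_segment p y \<Longrightarrow> \<alpha> \<noteq> y \<Longrightarrow> \<alpha> \<notin> Y1 \<union> Y2"
    using closest_in_segment[OF cY, of p q] Y1 Y2 by blast
  have sub: "closed_segment p y \<subseteq> closed_segment p q"
    using y(1) Y1 Y2 by (auto simp: subset_closed_segment)
  have N1: "Z m \<alpha> t < - r" if "\<alpha> \<in> closed_segment p y" "\<alpha> \<noteq> y" "0 \<le> t" "t \<le> 2 * pi" for \<alpha> t
    using y(3)[OF that(1,2)] sub that by (force simp: Y1)
  have N2: "Z ?m \<alpha> t < W t" if "\<alpha> \<in> closed_segment p y" "\<alpha> \<noteq> y" "\<bar>t\<bar> \<le> \<tau>" for \<alpha> t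
    using y(3)[OF that(1,2)] sub that by (force simp: Y2)
  have N1': "Z m \<alpha> t \<le> - r" if "\<alpha> \<in> closed_segment p y" "0 \<le> t" "t \<le> 2 * pi" for \<alpha> t
    using y(2) that N1
    by (intro le_on_closed_segment[of "\<lambda>\<alpha>. Z m \<alpha> t" p y _ \<alpha>])
      (auto intro!: continuous_intros less_imp_le simp: open_segment_def)
  have N2': "Z ?m \<alpha> t \<le> W t" if "\<alpha> \<in> closed_segment p y" "\<bar>t\<bar> \<le> \<tau>" for \<alpha> t
    using y(2) that N2
    by (intro le_on_closed_segment[of "\<lambda>\<alpha>. Z ?m \<alpha> t" p y _ \<alpha>])
      (auto intro!: continuous_intros less_imp_le simp: open_segment_def)
  have y_in: "y \<in> closed_segment p q" "y \<in> {alpha0 lam..abar}" using sub S(3) by auto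
  \<comment> \<open>At the first bad parameter -r can be reached only by tangency from below, which
    the positive acceleration there forbids; at the two end times the trajectory is at most abar <
    -r. So y fails only at spike m + 2.\<close>
  have y_low: "Z m y t < - r" if t: "0 \<le> t" "t \<le> 2 * pi" for t
  proof (rule ccontr)
    assume "\<not> ?thesis"
    then have eq: "Z m y t = - r" using N1'[of y t] t by simp
    obtain v where v: "traj (Z m y) v" using Z_traj by blast
    have "t \<noteq> 0" using shooting_le_W[OF st y_in(1), of 0] eq abar tau by auto
    moreover have "t \<noteq> 2 * pi" using N2'[of y 0] eq abar tau by (auto simp: Z_Suc_Suc)
    ultimately have t': "0 < t" "t < 2 * pi" using t by auto
    have "v t = 0"
      using trajD(1)[OF v]
    proof (rule DERIV_local_max[where d = "min t (2 * pi - t)"])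
      show "\<forall>x. \<bar>t - x\<bar> < min t (2 * pi - t) \<longrightarrow> Z m y x \<le> Z m y t"
        using N1'[of y] eq by auto
    qed (use t' in simp)
    obtain e where e: "e > 0" "\<And>h. 0 < h \<Longrightarrow> h < e \<Longrightarrow> v (t + h) > 0"
      using DERIV_pos_inc_right[OF trajD(2)[OF v, of t]] acc_minus_r eq \<open>v t = 0\<close> by auto
    define h where "h = min (e / 2) (2 * pi - t)"
    have h: "0 < h" "h < e" "t + h \<le> 2 * pi" using e t' by (auto simp: h_def min_def)
    have "Z m y t < Z m y (t + h)"
    proof (rule DERIV_pos_imp_increasing_open[of t "t + h" "Z m y"])
      fix x assume "t < x" "x < t + h"
      then have "v x > 0" using e(2)[of "x - t"] h by auto
      then show "\<exists>z. (Z m y has_real_derivative z) (at x) \<and> z > 0" using trajD(1)[OF v] by blast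
    qed (use h traj_cont[OF v] in auto)
    then show False using N1'[of y "t + h"] h t eq by simp
  qed
  have Zy: "Z ?m y \<tau> = b"
  proof -
    have "y \<notin> Y1" using y_low by (force simp: Y1)
    then obtain s where s: "\<bar>s\<bar> \<le> \<tau>" "Z ?m y s = W s"
      using y(1) N2'[of y] by (force simp: Y2)
    \<comment> \<open>The level -r still holds when the spike opens, which excludes both the left
      corner and coincidence with \<open>W\<close>.\<close>
    have left: "Z ?m y (- \<tau>) < b"
      using y_low[of "2 * pi - \<tau>"] tau tau_pi r_pos b_pos by (simp add: Z_Suc_Suc)
    have "\<not> \<bar>s\<bar> < \<tau>"
    proof
      assume "\<bar>s\<bar> < \<tau>"
      obtain v where "traj (Z ?m y) v" using Z_traj by blast
      from touch_spike[OF this N2'[of y] \<open>\<bar>s\<bar> < \<tau>\<close> s(2)] show False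
        using left by simp
    qed
    moreover have "s \<noteq> - \<tau>" using s left by auto
    ultimately show ?thesis using s by (cases "s = \<tau>") auto
  qed
  \<comment> \<open>Between p and y some trajectories may be below the strip by the centre of spike
    m + 2, too early for the new invariant. The new lower end is the point of A nearest to y;
    inserting p covers the case that p itself stays inside that long.\<close>
  define A where "A = insert p {\<alpha> \<in> closed_segment p y. Z m \<alpha> (2 * pi) \<le> - b}"
  have "closed {\<alpha>. Z m \<alpha> (2 * pi) \<le> - b}"
    by (intro closed_Collect_le continuous_intros)
  then have "compact (closed_segment p y \<inter> {\<alpha>. Z m \<alpha> (2 * pi) \<le> - b})"
    by (intro compact_Int_closed compact_segment)
  then have cA: "compact A" unfolding A_def by (auto intro!: compact_insert simp: Int_def)
  have start: "- (real m * pi) \<le> 2 * pi"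
    using mult_nonneg_nonneg[of "real m" pi] pi_ge_zero by linarith
  have "y \<notin> A"
  proof -
    have "Z m y (2 * pi) > - b"
      using Z_stick_down[OF y_in(2) start, of "\<tau> + 2 * pi"] Zy tau b_pos by (fastforce simp: Z_Suc_Suc)
    then show ?thesis using y(2) by (simp add: A_def)
  qed
  then obtain p' where p': "p' \<in> A" "p' \<noteq> y"
      "\<And>\<alpha>. \<alpha> \<in> closed_segment y p' \<Longrightarrow> \<alpha> \<noteq> p' \<Longrightarrow> \<alpha> \<notin> A"
    using closest_in_segment[OF cA, of y p] by (auto simp: A_def closed_segment_commute)
  have sub': "closed_segment p' y \<subseteq> closed_segment p y"
    using p'(1) by (auto simp: A_def subset_closed_segment)
  have NA: "- b < Z m \<alpha> (2 * pi)" if "\<alpha> \<in> closed_segment p' y" "\<alpha> \<noteq> p'" for \<alpha>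
    using p'(3)[of \<alpha>] that sub' by (force simp: A_def closed_segment_commute)
  have NA': "- b \<le> Z m \<alpha> (2 * pi)" if "\<alpha> \<in> closed_segment p' y" for \<alpha>
  proof -
    have "- Z m \<alpha> (2 * pi) \<le> b"
      using p'(2) that NA
      by (intro le_on_closed_segment[of "\<lambda>\<alpha>. - Z m \<alpha> (2 * pi)" p' y _ \<alpha>])
        (auto intro!: continuous_intros simp: open_segment_def minus_le_iff less_imp_le)
    then show ?thesis by simp
  qed
  have "shooting ?m p' y"
    unfolding shooting_def
  proof (intro conjI ballI allI impI)
    show "?m \<notin> Sig" using Sig_gap assms(2) by blast
    show "closed_segment p' y \<subseteq> {alpha0 lam..abar}" using sub sub' S(3) by blast
    show "\<bar>Z ?m \<alpha> t\<bar> < b"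
      if \<alpha>: "\<alpha> \<in> closed_segment p' y" and t: "- (real ?m * pi) \<le> t \<and> t < - pi" for \<alpha> t
    proof -
      have \<alpha>': "\<alpha> \<in> closed_segment p y" "\<alpha> \<in> {alpha0 lam..abar}" using \<alpha> sub sub' S(3) by blast+
      have t': "- (real m * pi) \<le> t + 2 * pi" "t + 2 * pi < 2 * pi"
        using t pi_gt_zero by (simp add: algebra_simps, linarith)
      have "Z m \<alpha> (2 * pi) \<le> b" using N1'[OF \<alpha>'(1), of "2 * pi"] r_pos b_pos by simp
      then have "Z m \<alpha> (t + 2 * pi) < b"
        using Z_stick_up[OF \<alpha>'(2) t'] by fastforce
      moreover have "Z m \<alpha> (t + 2 * pi) > - b"
        using Z_stick_down[OF \<alpha>'(2) t'] NA'[OF \<alpha>] by fastforce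
      ultimately show ?thesis by (simp add: Z_Suc_Suc)
    qed
    show "\<exists>T\<ge>- pi. - (real ?m * pi) \<le> T \<and> Z ?m p' T = - b
        \<and> (\<forall>t. 0 \<le> t \<and> t < T \<longrightarrow> - b < Z ?m p' t \<and> Z ?m p' t < - r)"
    \<comment> \<open>Either the new end reaches -b exactly at the centre, time 0 in the new
      coordinates, or it is the old p, whose later exit time is merely shifted.\<close>
    proof (cases "Z m p' (2 * pi) \<le> - b")
      case True
      then have "Z m p' (2 * pi) = - b" using NA'[of p'] by simp
      then show ?thesis by (intro exI[of _ 0]) (auto simp: Z_Suc_Suc)
    next
      case False
      then have "p' = p" using p'(1) by (auto simp: A_def)
      have p_in: "p \<in> {alpha0 lam..abar}" using S(3) by auto
      obtain T where T: "- (real m * pi) \<le> T" "Z m p T = - b"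
          "\<And>t. 0 \<le> t \<Longrightarrow> t < T \<Longrightarrow> - b < Z m p t \<and> Z m p t < - r"
        using S(5) by blast
      have "T \<ge> 2 * pi"
        using Z_stick_down[OF p_in T(1), of "2 * pi"] T(2) False \<open>p' = p\<close> by fastforce
      show ?thesis
      proof (intro exI[of _ "T - 2 * pi"] conjI)
        show "- pi \<le> T - 2 * pi" using \<open>T \<ge> 2 * pi\<close> pi_ge_zero by linarith
        show "- (real ?m * pi) \<le> T - 2 * pi" using T(1) by (simp add: algebra_simps)
        show "\<forall>t. 0 \<le> t \<and> t < T - 2 * pi \<longrightarrow> - b < Z ?m p' t \<and> Z ?m p' t < - r"
          using T(3) \<open>p' = p\<close> by (simp add: Z_Suc_Suc)
      qed (use T(2) \<open>p' = p\<close> in \<open>simp add: Z_Suc_Suc\<close>)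
    qed
    show "Z ?m \<alpha> t < W t" if "\<alpha> \<in> open_segment p' y" "\<bar>t\<bar> \<le> \<tau>" for \<alpha> t
      using N2 sub' that by (auto simp: open_segment_def)
    show "hits j \<alpha> \<longleftrightarrow> j \<in> Sig" if \<alpha>: "\<alpha> \<in> open_segment p' y" and j: "1 \<le> j \<and> j < ?m" for \<alpha> j
    proof -
      have \<alpha>1: "\<alpha> \<in> closed_segment p' y" "\<alpha> \<noteq> p'" "\<alpha> \<noteq> y" using \<alpha> by (auto simp: open_segment_def)
      have \<alpha>2: "\<alpha> \<in> closed_segment p y" "\<alpha> \<in> closed_segment p q" "\<alpha> \<in> {alpha0 lam..abar}"
        using \<alpha>1 sub sub' S(3) by blast+
      have "\<alpha> \<noteq> p" using \<alpha>1 p'(3)[of \<alpha>] by (auto simp: A_def closed_segment_commute)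
      moreover have "\<alpha> \<noteq> q" using y(3)[OF \<alpha>2(1) \<alpha>1(3)] qY by auto
      ultimately have o: "\<alpha> \<in> open_segment p q" using \<alpha>2 by (simp add: open_segment_def)
      consider "j < m" | "j = m" | "j = Suc m" using j by linarith
      then show ?thesis
      proof cases
        case 1
        then show ?thesis using S(8)[OF o] j by blast
      next
        case 2
        then show ?thesis using S(1) S(7)[OF o] by (force simp: hits_def)
      next
        case 3
        have s: "- (real m * pi) \<le> pi - \<tau>"
          using tau tau_pi mult_nonneg_nonneg[of "real m" pi] pi_ge_zero by linarith
        \<comment> \<open>Flipped, the trajectory is below b = W at the left corner of spike m + 1,
          while at the centre it exceeds r > abar = W; the crossing lies between.\<close>
        have "Z m \<alpha> (pi - \<tau>) > - b"
          using Z_stick_down[OF \<alpha>2(3) s, of "2 * pi"] NA[OF \<alpha>1(1,2)] tau by fastforce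
        then have "Z (Suc m) \<alpha> (- \<tau>) - W (- \<tau>) \<le> 0" by (simp add: Z_Suc)
        moreover have "0 \<le> Z (Suc m) \<alpha> 0 - W 0"
          using N1[OF \<alpha>2(1) \<alpha>1(3), of pi] abar r_pos by (simp add: Z_Suc)
        moreover have "continuous_on {-\<tau>..0} (\<lambda>t. Z (Suc m) \<alpha> t - W t)"
          by (intro continuous_intros)
        ultimately obtain t where "- \<tau> \<le> t" "t \<le> 0" "Z (Suc m) \<alpha> t - W t = 0"
          using IVT'[of "\<lambda>t. Z (Suc m) \<alpha> t - W t" "- \<tau>" 0 0] tau by auto
        then show ?thesis using 3 assms(2) tau by (auto simp: hits_def intro!: exI[of _ t])
      qed
    qed
  qed (use p' Zy in auto)
  then show ?thesis using that sub sub' by blast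
qed

section \<open>The initial parameter interval\<close>

lemma below_alpha0:
  assumes "\<alpha> < alpha0 lam" "0 \<le> t"
  shows "U \<alpha> t < alpha0 lam"
proof (rule ccontr)
  assume ge: "\<not> ?thesis"
  obtain v where v: "traj (U \<alpha>) v" "v 0 = 0" using U_ex by blast
  obtain s where s: "0 < s" "U \<alpha> s = alpha0 lam" "\<And>x. 0 \<le> x \<Longrightarrow> x < s \<Longrightarrow> U \<alpha> x < alpha0 lam"
    using first_hit[OF traj_cont[OF v(1)], of 0 t "alpha0 lam"] assms ge by auto
  have le: "U \<alpha> x \<le> alpha0 lam" if "0 \<le> x" "x \<le> s" for x
    using s(2) s(3)[of x] that by (cases "x = s") auto
  \<comment> \<open>At or below this level the cubic is at most -1, which the forcing cannot
    outweigh: the trajectory is concave, starts at rest and cannot climb.\<close>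
  have "acc x (U \<alpha> x) \<le> 0" if "0 \<le> x" "x \<le> s" for x
  proof -
    have "G (U \<alpha> x) \<le> - 1"
      using G_mono[OF le[OF that]] alpha0 by simp
    then have "G (U \<alpha> x) + cos x \<le> 0" using cos_le_one[of x] by linarith
    then show ?thesis by (simp add: acc_def divide_nonpos_nonneg)
  qed
  then have "v x \<le> 0" if "0 \<le> x" "x \<le> s" for x
    using DERIV_nonpos_imp_nonincreasing[of 0 x v] trajD(2)[OF v(1)] v(2) that by force
  then have "U \<alpha> s \<le> U \<alpha> 0"
    using s(1) trajD(1)[OF v(1)] by (intro DERIV_nonpos_imp_nonincreasing[of 0 s]) auto
  then show False using s assms by simp
qed

text \<open>A limit from below: starting at the level itself leaves no strict inequality for a
  first-crossing argument.\<close>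

lemma alpha0_le: "U (alpha0 lam) t \<le> alpha0 lam"
proof -
  have "U (alpha0 lam) \<bar>t\<bar> \<le> alpha0 lam"
  proof (rule continuous_le_on_closure[of "{..<alpha0 lam}" "\<lambda>\<alpha>. U \<alpha> \<bar>t\<bar>"])
    show "continuous_on (closure {..<alpha0 lam}) (\<lambda>\<alpha>. U \<alpha> \<bar>t\<bar>)"
      using continuous_Z[of _ "\<lambda>x. x" "\<lambda>_. \<bar>t\<bar>" 0] by simp
  qed (auto intro!: less_imp_le[OF below_alpha0])
  then show ?thesis by (simp add: U_abs)
qed

text \<open>Integrating acc <= (cos t - 1) / eps^2 twice from rest gives a bound with leading term -
  t^2 / (2 eps^2), which forces the exit.\<close>

lemma alpha0_exit:
  "\<exists>T\<ge>0. U (alpha0 lam) T = - b \<and> (\<forall>t. 0 \<le> t \<and> t < T \<longrightarrow> - b < U (alpha0 lam) t)"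
proof -
  let ?u = "U (alpha0 lam)" and ?a = "alpha0 lam"
  obtain v where v: "traj ?u v" "v 0 = 0" using U_ex by blast
  have acc: "acc x (?u x) \<le> (cos x - 1) / \<epsilon>\<^sup>2" for x
  proof -
    have "G (?u x) \<le> - 1" using G_mono[OF alpha0_le[of x]] alpha0 by simp
    then show ?thesis unfolding acc_def by (intro divide_right_mono) auto
  qed
  have v_le: "v t \<le> (sin t - t) / \<epsilon>\<^sup>2" if "t \<ge> 0" for t
  proof -
    have "v t - (sin t - t) / \<epsilon>\<^sup>2 \<le> v 0 - (sin 0 - 0) / \<epsilon>\<^sup>2"
    proof (rule DERIV_nonpos_imp_nonincreasing[OF that])
      fix x
      have "((\<lambda>t. v t - (sin t - t) / \<epsilon>\<^sup>2) has_real_derivative acc x (?u x) - (cos x - 1) / \<epsilon>\<^sup>2) (at x)"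
        by (intro DERIV_diff trajD(2)[OF v(1)] DERIV_cdivide DERIV_sin DERIV_ident)
      then show "\<exists>z. ((\<lambda>t. v t - (sin t - t) / \<epsilon>\<^sup>2) has_real_derivative z) (at x) \<and> z \<le> 0"
        using acc[of x] by force
    qed
    then show ?thesis using v(2) by simp
  qed
  have u_le: "?u t \<le> ?a + (2 - t\<^sup>2 / 2) / \<epsilon>\<^sup>2" if "t \<ge> 0" for t
  proof -
    have "?u t - (- cos t - t\<^sup>2 / 2) / \<epsilon>\<^sup>2 \<le> ?u 0 - (- cos 0 - 0\<^sup>2 / 2) / \<epsilon>\<^sup>2"
    proof (rule DERIV_nonpos_imp_nonincreasing[OF that])
      fix x :: real assume "0 \<le> x"
      have "((\<lambda>t. - cos t - t\<^sup>2 / 2) has_real_derivative sin x - x) (at x)"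
        by (auto intro!: derivative_eq_intros)
      from DERIV_diff[OF trajD(1)[OF v(1)] DERIV_cdivide[OF this]]
      have "((\<lambda>t. ?u t - (- cos t - t\<^sup>2 / 2) / \<epsilon>\<^sup>2) has_real_derivative v x - (sin x - x) / \<epsilon>\<^sup>2) (at x)" .
      then show "\<exists>z. ((\<lambda>t. ?u t - (- cos t - t\<^sup>2 / 2) / \<epsilon>\<^sup>2) has_real_derivative z) (at x) \<and> z \<le> 0"
        using v_le[OF \<open>0 \<le> x\<close>] by force
    qed
    then have "?u t \<le> ?a + (1 - cos t - t\<^sup>2 / 2) / \<epsilon>\<^sup>2"
      by (simp add: diff_divide_distrib)
    also have "\<dots> \<le> ?a + (2 - t\<^sup>2 / 2) / \<epsilon>\<^sup>2"
    proof -
      have "1 - cos t - t\<^sup>2 / 2 \<le> 2 - t\<^sup>2 / 2" using cos_ge_minus_one[of t] by linarith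
      then show ?thesis by (intro add_left_mono divide_right_mono) auto
    qed
    finally show ?thesis .
  qed
  \<comment> \<open>Chosen so that the bound in \<open>u_le\<close> equals -b.\<close>
  define t where "t = sqrt (4 + 2 * \<epsilon>\<^sup>2 * (b + ?a))"
  have "t\<^sup>2 = 4 + 2 * \<epsilon>\<^sup>2 * (b + ?a)" using alpha0(1) by (simp add: t_def)
  then have "(2 - t\<^sup>2 / 2) / \<epsilon>\<^sup>2 = - (b + ?a)" using eps by (simp add: field_simps)
  moreover have t0: "t \<ge> 0" using alpha0(1) by (simp add: t_def)
  ultimately have "- ?u t \<ge> b" using u_le[of t] by simp
  moreover have "- ?u 0 < b" using alpha0(1) by simp
  moreover have "continuous_on {0..t} (\<lambda>x. - ?u x)"
    by (intro continuous_on_minus traj_cont[OF v(1)])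
  ultimately obtain s where s: "0 < s" "- ?u s = b" "\<And>x. 0 \<le> x \<Longrightarrow> x < s \<Longrightarrow> - ?u x < b"
    using first_hit[of 0 t "\<lambda>x. - ?u x" b] t0 by metis
  show ?thesis
  proof (intro exI[of _ s] conjI allI impI)
    show "- b < ?u x" if "0 \<le> x \<and> x < s" for x using s(3)[of x] that by linarith
  qed (use s(1,2) in auto)
qed

text \<open>Here, in contrast to the later steps, coincidence with \<open>W\<close> is admissible,
  since \<open>W\<close> itself passes through the right corner; and evenness identifies the two
  corners.\<close>

lemma shooting_start: obtains y where "shooting 0 (alpha0 lam) y"
proof -
  let ?a = "alpha0 lam"
  define Y where "Y = {\<alpha> \<in> closed_segment ?a abar. \<exists>t\<in>{-\<tau>..\<tau>}. 0 \<le> Z 0 \<alpha> t - W t}"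
  have Y: "\<alpha> \<in> Y \<longleftrightarrow> \<alpha> \<in> closed_segment ?a abar \<and> (\<exists>t. \<bar>t\<bar> \<le> \<tau> \<and> W t \<le> U \<alpha> t)" for \<alpha>
    by (simp only: Y_def Bex_def diff_ge_0_iff_ge mem_tau mem_Collect_eq Z_0)
  have cY: "compact Y"
    unfolding Y_def using compact_exists_nonneg[of "\<lambda>x. Z 0 (fst x) (snd x) - W (snd x)"]
    by (simp add: continuous_intros del: Z_0)
  have seg: "closed_segment ?a abar = {?a..abar}" using abar_gt by (simp add: closed_segment_eq_real_ivl)
  have "U ?a t < W t" if "\<bar>t\<bar> \<le> \<tau>" for t
    using alpha0_le[of t] abar_gt W_ge[OF that] by linarith
  then have "?a \<notin> Y" by (force simp: Y)
  moreover have "abar \<in> Y" using tau by (auto simp: Y W_def intro!: exI[of _ 0])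
  ultimately obtain y where y: "y \<in> Y" "y \<noteq> ?a"
      "\<And>\<alpha>. \<alpha> \<in> closed_segment ?a y \<Longrightarrow> \<alpha> \<noteq> y \<Longrightarrow> \<alpha> \<notin> Y"
    using closest_in_segment[OF cY, of ?a abar] Y by blast
  have sub: "closed_segment ?a y \<subseteq> closed_segment ?a abar"
    using y(1) by (simp add: Y subset_closed_segment)
  have N: "U \<alpha> t < W t" if "\<alpha> \<in> closed_segment ?a y" "\<alpha> \<noteq> y" "\<bar>t\<bar> \<le> \<tau>" for \<alpha> t
    using y(3)[OF that(1,2)] sub that by (force simp: Y)
  have N': "U y t \<le> W t" if "\<bar>t\<bar> \<le> \<tau>" for t
    using y(2) that N continuous_Z[of UNIV "\<lambda>x. x" "\<lambda>_. t" 0]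
    by (intro le_on_closed_segment[of "\<lambda>\<alpha>. U \<alpha> t" ?a y _ y])
      (auto intro!: less_imp_le simp: open_segment_def)
  obtain s where s: "\<bar>s\<bar> \<le> \<tau>" "U y s = W s"
    using y(1) N' by (force simp: Y)
  have "U y \<tau> = b"
  proof (cases "\<bar>s\<bar> = \<tau>")
    case True
    then show ?thesis using s(2) U_abs[of y s] W_abs[of s] by simp
  next
    case False
    obtain v where "traj (U y) v" using U_ex by blast
    from touch_spike[OF this N' _ s(2), of \<tau>] show ?thesis using s(1) False by simp
  qed
  moreover have "\<exists>T\<ge>- pi. - (real 0 * pi) \<le> T \<and> Z 0 ?a T = - b
      \<and> (\<forall>t. 0 \<le> t \<and> t < T \<longrightarrow> - b < Z 0 ?a t \<and> Z 0 ?a t < - r)"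
  proof -
    obtain T where T: "T \<ge> 0" "U ?a T = - b" "\<forall>t. 0 \<le> t \<and> t < T \<longrightarrow> - b < U ?a t"
      using alpha0_exit by blast
    have "U ?a t < - r" for t using alpha0_le[of t] alpha0(2) by linarith
    then show ?thesis
      using T order_trans[of "- pi" 0 T] by (intro exI[of _ T]) auto
  qed
  ultimately have "shooting 0 ?a y"
    unfolding shooting_def
  proof (intro conjI ballI allI impI)
    show "\<bar>Z 0 \<alpha> t\<bar> < b" if "- (real 0 * pi) \<le> t \<and> t < - pi" for \<alpha> t
    proof -
      have "t < 0" using that pi_gt_zero by linarith
      then show ?thesis using that by simp
    qed
    show "Z 0 \<alpha> t < W t" if "\<alpha> \<in> open_segment ?a y" "\<bar>t\<bar> \<le> \<tau>" for \<alpha> t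
      using N that by (simp add: open_segment_def)
  qed (use Sig0 y(2) sub seg in auto)
  then show ?thesis using that by blast
qed

section \<open>The limiting parameter\<close>

lemma shooting_step:
  assumes "shooting m p q"
  shows "\<exists>m' p' q'. m < m' \<and> shooting m' p' q' \<and> closed_segment p' q' \<subseteq> closed_segment p q"
  using shooting_skip[OF assms] shooting_cross[OF assms] by (metis Suc_lessD lessI)

lemma pattern_exists:
  "\<exists>\<alpha>. alpha0 lam < \<alpha> \<and> \<alpha> < abar \<and> (\<forall>t. \<bar>U \<alpha> t\<bar> < b)
      \<and> \<not> hits 0 \<alpha> \<and> (\<forall>j\<ge>1. hits j \<alpha> \<longleftrightarrow> j \<in> Sig)"
proof -
  \<comment> \<open>The state of the choice is the spike index with the two ends. Pinning the index
    to 0 at the start yields avoidance of spike 0.\<close>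
  define P where "P = (\<lambda>(n::nat) (m, p, q). shooting m p q \<and> (n = 0 \<longrightarrow> m = 0))"
  define R where "R = (\<lambda>(n::nat) (m::nat, p, q) (m'::nat, p'::real, q'::real).
    m < m' \<and> closed_segment p' q' \<subseteq> closed_segment p (q::real))"
  have "\<exists>f. \<forall>n. P n (f n) \<and> R n (f n) (f (Suc n))"
  proof (rule dependent_nat_choice)
    obtain y where "shooting 0 (alpha0 lam) y" by (rule shooting_start)
    then show "\<exists>x. P 0 x" unfolding P_def by (intro exI[of _ "(0, alpha0 lam, y)"]) simp
  next
    fix x n assume "P n x"
    then show "\<exists>x'. P (Suc n) x' \<and> R n x x'"
      unfolding P_def R_def using shooting_step by (cases x) fastforce
  qed
  then obtain f where f: "\<And>n. P n (f n)" "\<And>n. R n (f n) (f (Suc n))" by blast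
  define m p q where "m n = fst (f n)" and "p n = fst (snd (f n))" and "q n = snd (snd (f n))" for n
  have sh: "shooting (m n) (p n) (q n)" and m0: "m 0 = 0"
    and mS: "m n < m (Suc n)" and seg: "closed_segment (p (Suc n)) (q (Suc n)) \<subseteq> closed_segment (p n) (q n)" for n
    using f(1)[of n] f(1)[of 0] f(2)[of n] by (auto simp: P_def R_def m_def p_def q_def split_beta)
  have m_ge: "n \<le> m n" for n
    by (induction n) (use mS in \<open>auto simp: m0 Suc_le_eq intro: le_less_trans\<close>)
  have nested: "closed_segment (p n') (q n') \<subseteq> closed_segment (p n) (q n)" if "n \<le> n'" for n n'
    using that by (induction rule: dec_induct) (use seg in auto)
  have "(\<Inter>n. closed_segment (p n) (q n)) \<noteq> {}"
    by (rule compact_nest) (auto simp: nested)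
  then obtain \<alpha> where \<alpha>: "\<And>n. \<alpha> \<in> closed_segment (p n) (q n)" by auto
  have bound: "\<bar>U \<alpha> t\<bar> < b" for t
  proof -
    \<comment> \<open>The invariant controls times before -pi relative to spike m, that is original
      times before (m - 1) pi; hence the summand 1.\<close>
    obtain n where n: "\<bar>t\<bar> / pi + 1 < real n" using reals_Archimedean2 by blast
    also have "real n \<le> real (m n)" using m_ge by simp
    finally have "\<bar>t\<bar> < (real (m n) - 1) * pi" using pi_gt_zero by (simp add: field_simps)
    then have "\<bar>Z (m n) \<alpha> (\<bar>t\<bar> - real (m n) * pi)\<bar> < b"
      using shootingD(4)[OF sh \<alpha>[of n], of "\<bar>t\<bar> - real (m n) * pi"] by (simp add: algebra_simps)
    then show ?thesis by (simp add: abs_Z U_abs)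
  qed
  \<comment> \<open>Both end trajectories reach the boundary of the strip at some finite time and
    the limiting one never does, so it inherits the strict statements on open segments.\<close>
  have open_seg: "\<alpha> \<in> open_segment (p n) (q n)" for n
  proof -
    have bZ: "\<bar>Z (m n) \<alpha> t\<bar> < b" for t using bound by (simp add: abs_Z)
    have "\<alpha> \<noteq> q n" using bZ[of \<tau>] shootingD(6)[OF sh[of n]] b_pos by auto
    moreover have "\<alpha> \<noteq> p n" using bZ shootingD(5)[OF sh[of n]] b_pos
      by (metis abs_minus_cancel abs_of_pos less_irrefl)
    ultimately show ?thesis using \<alpha>[of n] by (simp add: open_segment_def)
  qed
  have "\<not> hits 0 \<alpha>"
    using shootingD(7)[OF sh[of 0] open_seg[of 0]] unfolding m0 hits_def by (metis less_irrefl)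
  moreover have "hits j \<alpha> \<longleftrightarrow> j \<in> Sig" if "j \<ge> 1" for j
    using shootingD(8)[OF sh open_seg[of "Suc j"] that] m_ge[of "Suc j"] by simp
  moreover have "alpha0 lam < \<alpha> \<and> \<alpha> < abar"
  proof -
    have "closed_segment (p 0) (q 0) \<subseteq> {alpha0 lam..abar}" using shootingD(3)[OF sh] .
    then have "p 0 \<in> {alpha0 lam..abar}" "q 0 \<in> {alpha0 lam..abar}" by auto
    then show ?thesis
      using open_seg[of 0] by (auto simp: open_segment_eq_real_ivl split: if_splits)
  qed
  ultimately show ?thesis using bound by blast
qed

section \<open>Spike graphs in the original coordinates\<close>

lemma spike_graph_eq:
  "spike_graph \<epsilon> lam b abar j
     = (\<lambda>t. (t, (-1) powi j * W (t - of_int j * pi))) ` {of_int j * pi - \<tau>..of_int j * pi + \<tau>}"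
  unfolding spike_graph_def graph_on_def spike_interval_eq
  by (intro image_cong refl) (auto simp: spike_ext_eq abs_le_iff)

lemma meets_iff_hits:
  assumes "\<And>t. \<bar>U \<alpha> t\<bar> < b" "j \<ge> 1"
  shows "graph_on (sol \<epsilon> lam \<alpha>) {0<..} \<inter> spike_graph \<epsilon> lam b abar (int j) \<noteq> {} \<longleftrightarrow> hits j \<alpha>"
proof -
  have sol: "sol \<epsilon> lam \<alpha> = U \<alpha>" using global_solution(2)[of \<alpha>] assms(1) less_imp_le by blast
  have j: "real j * pi \<ge> pi" using mult_right_mono[of 1 "real j" pi] assms(2) by simp
  have sgn: "U \<alpha> t = (-1)^j * W (t - real j * pi) \<longleftrightarrow> Z j \<alpha> (t - real j * pi) = W (t - real j * pi)" for t
    by (cases "even j") (auto simp: Z_def)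
  have "graph_on (sol \<epsilon> lam \<alpha>) {0<..} \<inter> spike_graph \<epsilon> lam b abar (int j) \<noteq> {}
      \<longleftrightarrow> (\<exists>t>0. \<bar>t - real j * pi\<bar> \<le> \<tau> \<and> Z j \<alpha> (t - real j * pi) = W (t - real j * pi))"
    unfolding sol spike_graph_eq graph_on_def by (auto simp: sgn[symmetric] abs_le_iff)
  also have "\<dots> \<longleftrightarrow> hits j \<alpha>"
  proof
    assume "hits j \<alpha>"
    then obtain s where "\<bar>s\<bar> \<le> \<tau>" "Z j \<alpha> s = W s" by (auto simp: hits_def)
    then show "\<exists>t>0. \<bar>t - real j * pi\<bar> \<le> \<tau> \<and> Z j \<alpha> (t - real j * pi) = W (t - real j * pi)"
    proof (intro exI[of _ "s + real j * pi"] conjI)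
      show "0 < s + real j * pi" using j tau \<open>\<bar>s\<bar> \<le> \<tau>\<close> by linarith
    qed auto
  qed (auto simp: hits_def)
  finally show ?thesis .
qed

text \<open>Spikes of negative index end before time 0, and of spike 0 only the right half is
  relevant.\<close>

lemma no_meet_nonpos:
  assumes "\<And>t. \<bar>U \<alpha> t\<bar> < b" "\<not> hits 0 \<alpha>" "j \<le> 0"
  shows "graph_on (sol \<epsilon> lam \<alpha>) {0<..} \<inter> spike_graph \<epsilon> lam b abar j = {}"
proof -
  have sol: "sol \<epsilon> lam \<alpha> = U \<alpha>" using global_solution(2)[of \<alpha>] assms(1) less_imp_le by blast
  show ?thesis
  proof (cases "j = 0")
    case True
    then show ?thesis
      using assms(2) unfolding sol spike_graph_eq graph_on_def by (auto simp: hits_def)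
  next
    case False
    then have "real_of_int j \<le> - 1" using assms(3) by linarith
    from mult_right_mono[OF this, of pi] have "of_int j * pi + \<tau> < 0" using tau by simp
    then show ?thesis unfolding spike_graph_eq graph_on_def by auto
  qed
qed

end

theorem theorem12:
  fixes \<epsilon> lam b \<alpha>bar :: real and \<sigma> :: "nat \<Rightarrow> int" and N :: enat
  assumes "\<epsilon> > 0"
    and "lam > lambda0"
    and "b > 0" and "b^3 - lam * b - 1 > 0"
    and "alpha0 lam < \<alpha>bar" and "\<alpha>bar < - sqrt (lam / 3)"
    and "\<exists>\<tau>. 0 < \<tau> \<and> \<tau> < pi / 2 \<and> {0..\<tau>} \<subseteq> max_interval \<epsilon> lam \<alpha>bar
           \<and> strict_mono_on {0..\<tau>} (sol \<epsilon> lam \<alpha>bar) \<and> sol \<epsilon> lam \<alpha>bar \<tau> = b"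
    and "\<And>k. enat k < N \<Longrightarrow> \<sigma> k > 0"
    and "\<And>k. enat (Suc k) < N \<Longrightarrow> \<sigma> (Suc k) - \<sigma> k \<ge> 2"
  shows "\<exists>\<alpha>. alpha0 lam < \<alpha> \<and> \<alpha> < \<alpha>bar \<and> max_interval \<epsilon> lam \<alpha> = UNIV
           \<and> (\<forall>k. enat k < N \<longrightarrow>
                graph_on (sol \<epsilon> lam \<alpha>) {0<..} \<inter> spike_graph \<epsilon> lam b \<alpha>bar (\<sigma> k) \<noteq> {})
           \<and> (\<forall>j. j \<notin> {\<sigma> k | k. enat k < N} \<longrightarrow>
                graph_on (sol \<epsilon> lam \<alpha>) {0<..} \<inter> spike_graph \<epsilon> lam b \<alpha>bar j = {})"
proof -
  obtain \<tau> where \<tau>: "0 < \<tau>" "\<tau> < pi / 2" "{0..\<tau>} \<subseteq> max_interval \<epsilon> lam \<alpha>bar"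
      "strict_mono_on {0..\<tau>} (sol \<epsilon> lam \<alpha>bar)" "sol \<epsilon> lam \<alpha>bar \<tau> = b"
    using assms(7) by blast
  define Sig where "Sig = {n. \<exists>k. enat k < N \<and> \<sigma> k = int n}"
  \<comment> \<open>The gap is extended to arbitrary pairs, since two neighbouring elements of
    \<open>Sig\<close> carry no information on their positions in the sequence.\<close>
  have gap: "\<sigma> l - \<sigma> k \<ge> 2" if "k < l" "enat l < N" for k l
    using that
  proof (induction l)
    case (Suc l)
    then have "enat l < N" by (meson enat_ord_simps(2) lessI order_less_trans)
    then show ?case using Suc assms(9)[of l] by (cases "k = l") (auto simp: less_Suc_eq)
  qed simp
  have "0 \<notin> Sig" using assms(8) by (force simp: Sig_def)
  moreover have "Suc n \<notin> Sig" if n: "n \<in> Sig" for n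
  proof
    assume "Suc n \<in> Sig"
    moreover obtain k where "enat k < N" "\<sigma> k = int n" using n by (auto simp: Sig_def)
    ultimately obtain k l where kl: "enat k < N" "\<sigma> k = int n" "enat l < N" "\<sigma> l = int (Suc n)"
      by (auto simp: Sig_def)
    show False
    proof (cases k l rule: linorder_cases)
      case less
      from gap[OF this kl(3)] show False using kl by simp
    next
      case greater
      from gap[OF this kl(1)] show False using kl by simp
    qed (use kl in simp)
  qed
  ultimately interpret spike_pattern \<epsilon> lam b \<alpha>bar \<tau> Sig
    using assms \<tau> by unfold_locales auto
  obtain \<alpha> where \<alpha>: "alpha0 lam < \<alpha>" "\<alpha> < \<alpha>bar" and bound: "\<And>t. \<bar>U \<alpha> t\<bar> < b"
      and h0: "\<not> hits 0 \<alpha>" and h: "\<And>j. j \<ge> 1 \<Longrightarrow> hits j \<alpha> \<longleftrightarrow> j \<in> Sig"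
    using pattern_exists by blast
  show ?thesis
  proof (intro exI conjI allI impI)
    show "max_interval \<epsilon> lam \<alpha> = UNIV" using global_solution(1)[of \<alpha>] bound less_imp_le by blast
    fix k assume k: "enat k < N"
    define n where "n = nat (\<sigma> k)"
    have n: "\<sigma> k = int n" "n \<ge> 1" using assms(8)[OF k] by (auto simp: n_def)
    then have "n \<in> Sig" using k by (auto simp: Sig_def)
    then show "graph_on (sol \<epsilon> lam \<alpha>) {0<..} \<inter> spike_graph \<epsilon> lam b \<alpha>bar (\<sigma> k) \<noteq> {}"
      using meets_iff_hits[OF bound n(2)] h[OF n(2)] n(1) by simp
  next
    fix j assume j: "j \<notin> {\<sigma> k | k. enat k < N}"
    show "graph_on (sol \<epsilon> lam \<alpha>) {0<..} \<inter> spike_graph \<epsilon> lam b \<alpha>bar j = {}"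
    proof (cases "j \<le> 0")
      case False
      define n where "n = nat j"
      have n: "j = int n" "n \<ge> 1" using False by (auto simp: n_def)
      have "n \<notin> Sig" using j n by (auto simp: Sig_def)
      then show ?thesis using meets_iff_hits[OF bound n(2)] h[OF n(2)] n(1) by simp
    qed (rule no_meet_nonpos[OF bound h0])
  qed (use \<alpha> in auto)
qed

end
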